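(* Let $n\ge5$ be odd, and let $\mathfrak g\cong\mathfrak{so}(2n,\mathbb C)$ be the Lie algebra of complex $2n\times 2n$ matrices $Z$ with $Zq+qZ^T=0$, where $q$ is the anti-diagonal matrix with all anti-diagonal entries $1$. Let $\sigma$ be the permutation of $\{1,\dots,2n\}$ exchanging $1\leftrightarrow 2n$ and $n\leftrightarrow n+1$ and fixing all other indices, and let $\lambda_1$ be the involution of $\mathfrak g$ induced by $E_{jk}\mapsto E_{\sigma(j)\sigma(k)}$. Let $\mathfrak g=\mathfrak g_0\oplus\mathfrak g_1$ be its decomposition into $+1$ and $-1$ eigenspaces, and let $\tilde{\mathfrak g}_0\subset\mathfrak g$ be the set of matrices in $\mathfrak g$ whose first and last rows and columns vanish and whose $n$-th and $(n+1)$-st columns coincide. Then $\tilde{\mathfrak g}_0$ is a subalgebra of $\mathfrak g_0$ isomorphic to $\mathfrak{so}(2n-3,\mathbb C)$ (type $B_{n-2}$); $\mathfrak g_0=\tilde{\mathfrak g}_0\oplus V$, where as a $\tilde{\mathfrak g}_0$-module $V$ is the direct sum of the vector representation of dimension $2(n-2)+1$ and a trivial one-dimensional representation; $\mathfrak g_0\cong\mathfrak{so}(2n-2,\mathbb C)\oplus\mathbb C$; and $\dim\mathfrak g_0=2n^2-5n+4$.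
   Context: $E_{jk}$ are the matrix units of order $2n$. The vector representation of $\mathfrak{so}(m,\mathbb C)$ is its standard $m$-dimensional representation; $\tilde{\mathfrak g}_0$ acts on $V$ by commutators. *)

theory Defs
  imports "Jordan_Normal_Form.VS_Connect"
begin

section \<open>Lie algebras and their modules\<close>

record ('a, 'v) lie_alg = "('a, 'v) module" +
  lie_bracket :: "'v \<Rightarrow> 'v \<Rightarrow> 'v"

locale lie_algebra = vectorspace K L
  for K :: "('a, 'r) ring_scheme" and L :: "('a, 'v, 'e) lie_alg_scheme" (structure) +
  assumes bracket_closed:
      "\<lbrakk>x \<in> carrier L; y \<in> carrier L\<rbrakk> \<Longrightarrow> lie_bracket L x y \<in> carrier L"
    and bracket_add_left:
      "\<lbrakk>x \<in> carrier L; y \<in> carrier L; z \<in> carrier L\<rbrakk>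
        \<Longrightarrow> lie_bracket L (x \<oplus> y) z = lie_bracket L x z \<oplus> lie_bracket L y z"
    and bracket_add_right:
      "\<lbrakk>x \<in> carrier L; y \<in> carrier L; z \<in> carrier L\<rbrakk>
        \<Longrightarrow> lie_bracket L x (y \<oplus> z) = lie_bracket L x y \<oplus> lie_bracket L x z"
    and bracket_smult_left:
      "\<lbrakk>c \<in> carrier K; x \<in> carrier L; y \<in> carrier L\<rbrakk>
        \<Longrightarrow> lie_bracket L (c \<odot> x) y = c \<odot> lie_bracket L x y"
    and bracket_smult_right:
      "\<lbrakk>c \<in> carrier K; x \<in> carrier L; y \<in> carrier L\<rbrakk>
        \<Longrightarrow> lie_bracket L x (c \<odot> y) = c \<odot> lie_bracket L x y"
    and bracket_self: "x \<in> carrier L \<Longrightarrow> lie_bracket L x x = \<zero>"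
    and jacobi:
      "\<lbrakk>x \<in> carrier L; y \<in> carrier L; z \<in> carrier L\<rbrakk>
        \<Longrightarrow> lie_bracket L x (lie_bracket L y z) \<oplus> lie_bracket L y (lie_bracket L z x)
            \<oplus> lie_bracket L z (lie_bracket L x y) = \<zero>"

definition lie_subalgebra ::
  "('a, 'r) ring_scheme \<Rightarrow> 'v set \<Rightarrow> ('a, 'v, 'e) lie_alg_scheme \<Rightarrow> bool" where
  "lie_subalgebra K H L \<longleftrightarrow>
     subspace K H L \<and> (\<forall>x\<in>H. \<forall>y\<in>H. lie_bracket L x y \<in> H)"

definition lie_iso ::
  "('a, 'r) ring_scheme \<Rightarrow> ('a, 'v, 'e) lie_alg_scheme \<Rightarrow> ('a, 'w, 'f) lie_alg_scheme
     \<Rightarrow> ('v \<Rightarrow> 'w) \<Rightarrow> bool" where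
  "lie_iso K L M f \<longleftrightarrow>
     lie_algebra K L \<and> lie_algebra K M \<and> linear_map K L M f \<and>
     bij_betw f (carrier L) (carrier M) \<and>
     (\<forall>x\<in>carrier L. \<forall>y\<in>carrier L. f (lie_bracket L x y) = lie_bracket M (f x) (f y))"

definition lie_isomorphic ::
  "('a, 'r) ring_scheme \<Rightarrow> ('a, 'v, 'e) lie_alg_scheme \<Rightarrow> ('a, 'w, 'f) lie_alg_scheme \<Rightarrow> bool"
  where "lie_isomorphic K L M \<longleftrightarrow> (\<exists>f. lie_iso K L M f)"

definition lie_direct_sum ::
  "('a, 'v, 'e) lie_alg_scheme \<Rightarrow> ('a, 'w, 'f) lie_alg_scheme \<Rightarrow> ('a, 'v \<times> 'w) lie_alg" where
  "lie_direct_sum L M = module.extend (direct_sum L M)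
     (lie_alg.fields (\<lambda>x y. (lie_bracket L (fst x) (fst y), lie_bracket M (snd x) (snd y))))"

locale lie_module = L?: lie_algebra K L + M?: vectorspace K M
  for K :: "('a, 'r) ring_scheme" and L :: "('a, 'v, 'e) lie_alg_scheme"
    and M :: "('a, 'm, 'f) module_scheme" +
  fixes act :: "'v \<Rightarrow> 'm \<Rightarrow> 'm"
  assumes act_closed: "\<lbrakk>x \<in> carrier L; u \<in> carrier M\<rbrakk> \<Longrightarrow> act x u \<in> carrier M"
    and act_add_left:
      "\<lbrakk>x \<in> carrier L; y \<in> carrier L; u \<in> carrier M\<rbrakk>
        \<Longrightarrow> act (x \<oplus>\<^bsub>L\<^esub> y) u = act x u \<oplus>\<^bsub>M\<^esub> act y u"
    and act_add_right:
      "\<lbrakk>x \<in> carrier L; u \<in> carrier M; v \<in> carrier M\<rbrakk>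
        \<Longrightarrow> act x (u \<oplus>\<^bsub>M\<^esub> v) = act x u \<oplus>\<^bsub>M\<^esub> act x v"
    and act_smult_left:
      "\<lbrakk>c \<in> carrier K; x \<in> carrier L; u \<in> carrier M\<rbrakk>
        \<Longrightarrow> act (c \<odot>\<^bsub>L\<^esub> x) u = c \<odot>\<^bsub>M\<^esub> act x u"
    and act_smult_right:
      "\<lbrakk>c \<in> carrier K; x \<in> carrier L; u \<in> carrier M\<rbrakk>
        \<Longrightarrow> act x (c \<odot>\<^bsub>M\<^esub> u) = c \<odot>\<^bsub>M\<^esub> act x u"
    and act_bracket:
      "\<lbrakk>x \<in> carrier L; y \<in> carrier L; u \<in> carrier M\<rbrakk>
        \<Longrightarrow> act (lie_bracket L x y) u = act x (act y u) \<ominus>\<^bsub>M\<^esub> act y (act x u)"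

definition lie_module_iso ::
  "('a, 'r) ring_scheme \<Rightarrow> ('a, 'v, 'e) lie_alg_scheme
     \<Rightarrow> ('a, 'm, 'f) module_scheme \<Rightarrow> ('v \<Rightarrow> 'm \<Rightarrow> 'm)
     \<Rightarrow> ('a, 'n, 'g) module_scheme \<Rightarrow> ('v \<Rightarrow> 'n \<Rightarrow> 'n) \<Rightarrow> ('m \<Rightarrow> 'n) \<Rightarrow> bool" where
  "lie_module_iso K L M actM N actN f \<longleftrightarrow>
     lie_module K L M actM \<and> lie_module K L N actN \<and> linear_map K M N f \<and>
     bij_betw f (carrier M) (carrier N) \<and>
     (\<forall>x\<in>carrier L. \<forall>u\<in>carrier M. f (actM x u) = actN x (f u))"

definition direct_sum_act ::
  "('v \<Rightarrow> 'm \<Rightarrow> 'm) \<Rightarrow> ('v \<Rightarrow> 'n \<Rightarrow> 'n) \<Rightarrow> 'v \<Rightarrow> 'm \<times> 'n \<Rightarrow> 'm \<times> 'n" where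
  "direct_sum_act a b x u = (a x (fst u), b x (snd u))"

definition internal_direct_sum ::
  "('a, 'r) ring_scheme \<Rightarrow> ('a, 'v, 'e) module_scheme \<Rightarrow> 'v set \<Rightarrow> 'v set \<Rightarrow> bool" where
  "internal_direct_sum K M A B \<longleftrightarrow>
     subspace K A M \<and> subspace K B M \<and>
     LinearCombinations.module.submodule_sum M A B = carrier M \<and> A \<inter> B = {\<zero>\<^bsub>M\<^esub>}"


section \<open>Complex matrix Lie algebras\<close>

definition gl :: "nat \<Rightarrow> (complex, complex mat) lie_alg" where
  "gl m = module.extend (module_mat TYPE(complex) m m)
     (lie_alg.fields (\<lambda>X Y. X * Y - Y * X))"

definition so :: "nat \<Rightarrow> (complex, complex mat) lie_alg" where
  "so m = gl m\<lparr>carrier := {X \<in> carrier_mat m m. transpose_mat X = - X}\<rparr>"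

definition complex_line :: "(complex, complex) module" where
  "complex_line = \<lparr>carrier = UNIV, mult = (*), one = 1, zero = 0, add = (+), smult = (*)\<rparr>"

definition complex_lie :: "(complex, complex) lie_alg" where
  "complex_lie = module.extend complex_line (lie_alg.fields (\<lambda>_ _. 0))"


section \<open>The algebra \<open>\<gg>\<close> and its subspaces\<close>

text \<open>Matrix indices start at \<open>0\<close>: the mathematical index \<open>i\<close> with \<open>1 \<le> i \<le> 2n\<close> is \<open>i - 1\<close> below.\<close>

definition antidiag :: "nat \<Rightarrow> complex mat" where
  "antidiag m = mat m m (\<lambda>(i, j). if i + j + 1 = m then 1 else 0)"

definition g_alg :: "nat \<Rightarrow> (complex, complex mat) lie_alg" where
  "g_alg n = gl (2 * n)\<lparr>carrier := {Z \<in> carrier_mat (2 * n) (2 * n).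
     Z * antidiag (2 * n) + antidiag (2 * n) * transpose_mat Z = 0\<^sub>m (2 * n) (2 * n)}\<rparr>"

definition sigma :: "nat \<Rightarrow> nat \<Rightarrow> nat" where
  "sigma n i =
     (if i = 0 then 2 * n - 1 else if i = 2 * n - 1 then 0
      else if i = n - 1 then n else if i = n then n - 1 else i)"

definition matrix_unit :: "nat \<Rightarrow> nat \<Rightarrow> nat \<Rightarrow> complex mat" where
  "matrix_unit m j k = mat m m (\<lambda>(a, b). if a = j \<and> b = k then 1 else 0)"

text \<open>The linear extension of \<open>E\<^sub>j\<^sub>k \<mapsto> E\<^bsub>\<sigma>(j)\<sigma>(k)\<^esub>\<close>, applied to \<open>Z = \<Sum> Z\<^sub>j\<^sub>k E\<^sub>j\<^sub>k\<close>.\<close>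

definition lambda1 :: "nat \<Rightarrow> complex mat \<Rightarrow> complex mat" where
  "lambda1 n Z = mat (2 * n) (2 * n) (\<lambda>(a, b).
     \<Sum>j<2 * n. \<Sum>k<2 * n. Z $$ (j, k) * matrix_unit (2 * n) (sigma n j) (sigma n k) $$ (a, b))"

lemma sigma_less: "n > 0 \<Longrightarrow> i < 2 * n \<Longrightarrow> sigma n i < 2 * n"
  by (auto simp: sigma_def)

lemma sigma_sigma: "n > 1 \<Longrightarrow> sigma n (sigma n i) = i"
  by (auto simp: sigma_def)

lemma sigma_reverse:
  "n > 1 \<Longrightarrow> i < 2 * n \<Longrightarrow> sigma n (2 * n - Suc i) = 2 * n - Suc (sigma n i)"
proof -
  assume n: "n > 1" "i < 2 * n"
  then consider "i = 0" | "i = 2 * n - 1" | "i = n - 1" | "i = n"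
    | "i \<noteq> 0" "i \<noteq> 2 * n - 1" "i \<noteq> n - 1" "i \<noteq> n" by blast
  then show ?thesis
  proof cases
    case 5
    with n have "2 * n - Suc i \<noteq> 0" "2 * n - Suc i \<noteq> 2 * n - 1"
      "2 * n - Suc i \<noteq> n - 1" "2 * n - Suc i \<noteq> n" by linarith+
    with 5 show ?thesis by (simp only: sigma_def if_False)
  qed (use n in \<open>auto simp: sigma_def\<close>)
qed

lemma lambda1_index:
  assumes "n > 1" "a < 2 * n" "b < 2 * n"
  shows "lambda1 n Z $$ (a, b) = Z $$ (sigma n a, sigma n b)"
proof -
  have s: "a = sigma n j \<longleftrightarrow> j = sigma n a" for a j
    using sigma_sigma[OF assms(1)] by metis
  have "lambda1 n Z $$ (a, b) =
      (\<Sum>j<2 * n. \<Sum>k<2 * n. if j = sigma n a then if k = sigma n b then Z $$ (j, k) else 0 else 0)"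
    unfolding lambda1_def using assms
    by (auto simp: matrix_unit_def s intro!: sum.cong)
  also have "\<dots> = (\<Sum>j<2 * n. if j = sigma n a then
      (\<Sum>k<2 * n. if k = sigma n b then Z $$ (j, k) else 0) else 0)"
    by (intro sum.cong) auto
  also have "\<dots> = Z $$ (sigma n a, sigma n b)"
    using assms sigma_less[of n] by simp
  finally show ?thesis .
qed

lemma lambda1_carrier [simp]: "lambda1 n Z \<in> carrier_mat (2 * n) (2 * n)"
  by (simp add: lambda1_def)

lemma lambda1_dim: "dim_row (lambda1 n Z) = 2 * n" "dim_col (lambda1 n Z) = 2 * n"
  by (simp_all add: lambda1_def)

lemma lambda1_lambda1:
  assumes "n > 1" "Z \<in> carrier_mat (2 * n) (2 * n)"
  shows "lambda1 n (lambda1 n Z) = Z"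
proof (rule eq_matI)
  fix i j assume "i < dim_row Z" "j < dim_col Z"
  then show "lambda1 n (lambda1 n Z) $$ (i, j) = Z $$ (i, j)"
    using assms by (simp add: lambda1_index sigma_less sigma_sigma)
qed (use assms in \<open>auto simp: lambda1_def\<close>)

lemma lambda1_mult:
  assumes n: "n > 1" and X: "X \<in> carrier_mat (2 * n) (2 * n)" and Y: "Y \<in> carrier_mat (2 * n) (2 * n)"
  shows "lambda1 n (X * Y) = lambda1 n X * lambda1 n Y"
proof (rule eq_matI)
  fix i j assume "i < dim_row (lambda1 n X * lambda1 n Y)" "j < dim_col (lambda1 n X * lambda1 n Y)"
  then have ij: "i < 2 * n" "j < 2 * n" by (simp_all add: lambda1_dim)
  have bij: "bij_betw (sigma n) {0..<2 * n} {0..<2 * n}"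
    using n by (intro bij_betw_byWitness[where f' = "sigma n"])
      (auto simp: sigma_sigma sigma_less)
  have "lambda1 n (X * Y) $$ (i, j) =
      (\<Sum>k\<in>{0..<2 * n}. X $$ (sigma n i, k) * Y $$ (k, sigma n j))"
    using n ij X Y by (simp add: lambda1_index sigma_less scalar_prod_def)
  also have "\<dots> = (\<Sum>k\<in>{0..<2 * n}. X $$ (sigma n i, sigma n k) * Y $$ (sigma n k, sigma n j))"
    by (rule sum.reindex_bij_betw[OF bij, symmetric])
  also have "\<dots> = (lambda1 n X * lambda1 n Y) $$ (i, j)"
    using n ij by (simp add: scalar_prod_def lambda1_index lambda1_dim)
  finally show "lambda1 n (X * Y) $$ (i, j) = (lambda1 n X * lambda1 n Y) $$ (i, j)" .
qed (simp_all only: index_mult_mat lambda1_dim)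

lemma g_alg_carrier_iff:
  "Z \<in> carrier (g_alg n) \<longleftrightarrow> Z \<in> carrier_mat (2 * n) (2 * n) \<and>
     (\<forall>i<2 * n. \<forall>j<2 * n. Z $$ (i, 2 * n - 1 - j) + Z $$ (j, 2 * n - 1 - i) = 0)"
proof -
  let ?q = "antidiag (2 * n)"
  have eq: "(Z * ?q + ?q * transpose_mat Z) $$ (i, j) =
      Z $$ (i, 2 * n - 1 - j) + Z $$ (j, 2 * n - 1 - i)"
    if Z: "Z \<in> carrier_mat (2 * n) (2 * n)" and ij: "i < 2 * n" "j < 2 * n" for i j
  proof -
    have k: "k + j + 1 = 2 * n \<longleftrightarrow> k = 2 * n - 1 - j" for k using ij by auto
    have l: "i + k + 1 = 2 * n \<longleftrightarrow> k = 2 * n - 1 - i" for k using ij by auto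
    have "(Z * ?q) $$ (i, j) = (\<Sum>k = 0..<2 * n. Z $$ (i, k) * (if k + j + 1 = 2 * n then 1 else 0))"
      using Z ij by (simp add: antidiag_def scalar_prod_def)
    also have "\<dots> = (\<Sum>k = 0..<2 * n. if k = 2 * n - 1 - j then Z $$ (i, k) else 0)"
      unfolding k by (intro sum.cong) auto
    finally have 1: "(Z * ?q) $$ (i, j) = Z $$ (i, 2 * n - 1 - j)" using ij by simp
    have "(?q * transpose_mat Z) $$ (i, j) =
        (\<Sum>k = 0..<2 * n. (if i + k + 1 = 2 * n then 1 else 0) * Z $$ (j, k))"
      using Z ij by (simp add: antidiag_def scalar_prod_def)
    also have "\<dots> = (\<Sum>k = 0..<2 * n. if k = 2 * n - 1 - i then Z $$ (j, k) else 0)"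
      unfolding l by (intro sum.cong) auto
    finally have 2: "(?q * transpose_mat Z) $$ (i, j) = Z $$ (j, 2 * n - 1 - i)" using ij by simp
    have "(Z * ?q + ?q * transpose_mat Z) $$ (i, j) = (Z * ?q) $$ (i, j) + (?q * transpose_mat Z) $$ (i, j)"
      using Z ij by (intro index_add_mat) (auto simp: antidiag_def)
    then show ?thesis using 1 2 by simp
  qed
  have "Z * ?q + ?q * transpose_mat Z = 0\<^sub>m (2 * n) (2 * n) \<longleftrightarrow>
     (\<forall>i<2 * n. \<forall>j<2 * n. Z $$ (i, 2 * n - 1 - j) + Z $$ (j, 2 * n - 1 - i) = 0)"
    if Z: "Z \<in> carrier_mat (2 * n) (2 * n)"
  proof -
    have zero: "A = 0\<^sub>m r c \<longleftrightarrow> (\<forall>i<r. \<forall>j<c. A $$ (i, j) = 0)"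
      if "A \<in> carrier_mat r c" for A :: "complex mat" and r c
      using that by (auto simp: mat_eq_iff)
    have "Z * ?q + ?q * transpose_mat Z \<in> carrier_mat (2 * n) (2 * n)"
      using Z by (auto simp: antidiag_def)
    from zero[OF this] eq[OF Z] show ?thesis by metis
  qed
  then show ?thesis
    by (simp add: g_alg_def cong: conj_cong)
qed

lemma lambda1_g_alg:
  assumes "n > 1" "Z \<in> carrier (g_alg n)"
  shows "lambda1 n Z \<in> carrier (g_alg n)"
  unfolding g_alg_carrier_iff
proof (intro conjI allI impI)
  fix i j assume ij: "i < 2 * n" "j < 2 * n"
  have less: "sigma n i < 2 * n" "sigma n j < 2 * n"
    using ij assms(1) by (simp_all add: sigma_less)
  have "Z $$ (i, 2 * n - 1 - j) + Z $$ (j, 2 * n - 1 - i) = 0" if "i < 2 * n" "j < 2 * n" for i j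
    using assms(2) that unfolding g_alg_carrier_iff by blast
  from this[OF less]
  show "lambda1 n Z $$ (i, 2 * n - 1 - j) + lambda1 n Z $$ (j, 2 * n - 1 - i) = 0"
    using assms(1) ij by (simp add: lambda1_index sigma_reverse)
qed simp

definition g0 :: "nat \<Rightarrow> complex mat set" where
  "g0 n = {Z \<in> carrier (g_alg n). lambda1 n Z = Z}"

definition g1 :: "nat \<Rightarrow> complex mat set" where
  "g1 n = {Z \<in> carrier (g_alg n). lambda1 n Z = - Z}"

definition g0_tilde :: "nat \<Rightarrow> complex mat set" where
  "g0_tilde n = {Z \<in> carrier (g_alg n).
     row Z 0 = 0\<^sub>v (2 * n) \<and> row Z (2 * n - 1) = 0\<^sub>v (2 * n) \<and>
     col Z 0 = 0\<^sub>v (2 * n) \<and> col Z (2 * n - 1) = 0\<^sub>v (2 * n) \<and>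
     col Z (n - 1) = col Z n}"

abbreviation lie_restrict ::
  "(complex, complex mat) lie_alg \<Rightarrow> complex mat set \<Rightarrow> (complex, complex mat) lie_alg" where
  "lie_restrict L H \<equiv> L\<lparr>carrier := H\<rparr>"

end

theory Submission
  imports Defs "Jordan_Normal_Form.Determinant"
begin

text \<open>
  The permutation matrix of \<open>\<sigma>\<close> preserves the symmetric form \<open>q\<close> and has a
  two-dimensional \<open>-1\<close> eigenspace, spanned by \<open>e\<^sub>1 - e\<^bsub>2n\<^esub>\<close> and \<open>e\<^sub>n - e\<^bsub>n+1\<^esub>\<close>.
  In a \<open>q\<close>-orthonormal basis of eigenvectors containing the normalized \<open>e\<^sub>1 + e\<^bsub>2n\<^esub>\<close>, the algebra
  \<open>\<gg>\<close> becomes the skew-symmetric matrices, \<open>\<gg>\<^sub>0\<close> those that are block diagonal for the splitting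
  into eigenspaces, i.e. \<open>so(2n-2) \<oplus> so(2)\<close>, and the subalgebra \<open>g0_tilde\<close> those that moreover
  kill \<open>e\<^sub>1 + e\<^bsub>2n\<^esub>\<close>, a copy of \<open>so(2n-3)\<close>. The complement \<open>V\<close> consists of the column of
  \<open>so(2n-2)\<close> belonging to \<open>e\<^sub>1 + e\<^bsub>2n\<^esub>\<close>, which is the vector representation, and of \<open>so(2)\<close>.
\<close>

section \<open>Subalgebras of \<open>gl m\<close>\<close>

text \<open>The two transpositions in \<sigma> exchange exactly indices that q pairs, so \<sigma>
  preserves each hyperbolic plane spanned by e_j and e_{2n+1-j}. Passing to the normalized sum and
  difference in every plane therefore diagonalizes q and \<sigma> at once. The difference has
  q-square -2, which is where the factor \<i> comes from. In the new basis each subspace involved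
  consists of all skew-symmetric matrices whose nonzero entries lie in positions allowed by a
  relation on indices. Brackets are then controlled by composing relations, direct sums by
  partitioning the off-diagonal positions, and dimensions by counting increasing pairs. A
  skew-symmetric matrix vanishes on the diagonal, so relations need only be compared at i \<noteq>
  j. The column conditions on \<open>g0_tilde\<close> say that Z kills e_1, e_{2n} and e_n -
  e_{n+1}. These span the whole -1 eigenspace of \<sigma> and one line of the +1 eigenspace, which
  is why only so(2n-3) is left of so(2n-2).\<close>

lemma gl_simps [simp]:
  "carrier (gl m) = carrier_mat m m" "add (gl m) = (+)" "zero (gl m) = 0\<^sub>m m m"
  "smult (gl m) = (\<cdot>\<^sub>m)" "lie_bracket (gl m) X Y = X * Y - Y * X"
  by (simp_all add: gl_def module.extend_def lie_alg.fields_def module_mat_simps)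

lemma vectorspace_gl: "vectorspace class_ring (gl m)"
proof (rule vs_criteria[OF class_field], goal_cases)
  case 3
  then show ?case
    by (auto intro!: bexI[of _ "- v" for v])
qed (auto simp: assoc_add_mat add_smult_distrib_left_mat add_smult_distrib_right_mat
  comm_add_mat)

lemma subspace_gl_iff:
  "subspace class_ring W (gl m) \<longleftrightarrow> W \<subseteq> carrier_mat m m \<and> 0\<^sub>m m m \<in> W \<and>
     (\<forall>X\<in>W. \<forall>Y\<in>W. X + Y \<in> W) \<and> (\<forall>c. \<forall>X\<in>W. c \<cdot>\<^sub>m X \<in> W)"
  using vectorspace_gl[of m] vectorspace.axioms(1)[OF vectorspace_gl[of m]]
  by (auto simp: subspace_def submodule_def)

lemma vectorspace_restrict_gl:
  "subspace class_ring W (gl m) \<Longrightarrow> vectorspace class_ring (lie_restrict (gl m) W)"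
  using vectorspace.subspace_is_vs[OF vectorspace_gl] by auto

lemma subspace_restrict_gl:
  assumes "subspace class_ring W (gl m)" "subspace class_ring U (gl m)" "U \<subseteq> W"
  shows "subspace class_ring U (lie_restrict (gl m) W)"
  using assms vectorspace_restrict_gl[of W m] vectorspace.axioms(1)[OF vectorspace_restrict_gl[of W m]]
  unfolding subspace_gl_iff by (auto simp: subspace_def submodule_def)

lemma lie_subalgebra_gl_subspace:
  "lie_subalgebra class_ring H (gl m) \<Longrightarrow> subspace class_ring H (gl m)"
  by (simp add: lie_subalgebra_def)

text \<open>Writing a double bracket as four left-nested words turns the Jacobi identity, and later
  the module law of the adjoint action, into a cancellation among the six orderings of three
  matrices.\<close>

lemma commutator_commutator:
  fixes u v w :: "complex mat"
  assumes c: "u \<in> carrier_mat m m" "v \<in> carrier_mat m m" "w \<in> carrier_mat m m"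
  shows "u * (v * w - w * v) - (v * w - w * v) * u = u * v * w - u * w * v - v * w * u + w * v * u"
proof -
  have "u * (v * w - w * v) = u * v * w - u * w * v"
    using mult_minus_distrib_mat[OF c(1) mult_carrier_mat[OF c(2,3)] mult_carrier_mat[OF c(3,2)]]
    by (simp only: assoc_mult_mat[OF c] assoc_mult_mat[OF c(1,3,2)])
  moreover have "(v * w - w * v) * u = v * w * u - w * v * u"
    by (rule minus_mult_distrib_mat[OF mult_carrier_mat[OF c(2,3)] mult_carrier_mat[OF c(3,2)] c(1)])
  moreover have "u * v * w \<in> carrier_mat m m" "u * w * v \<in> carrier_mat m m"
    "v * w * u \<in> carrier_mat m m" "w * v * u \<in> carrier_mat m m" using c by auto
  moreover have "a - b - (d - f) = a - b - d + f"
    if "a \<in> carrier_mat m m" "b \<in> carrier_mat m m" "d \<in> carrier_mat m m"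
      "f \<in> carrier_mat m m" for a b d f :: "complex mat"
    using that by (intro eq_matI) auto
  ultimately show ?thesis by simp
qed

lemma lie_algebra_restrict_gl:
  assumes "lie_subalgebra class_ring H (gl m)"
  shows "lie_algebra class_ring (lie_restrict (gl m) H)"
proof -
  have H: "H \<subseteq> carrier_mat m m" and b: "\<And>X Y. X \<in> H \<Longrightarrow> Y \<in> H \<Longrightarrow> X * Y - Y * X \<in> H"
    using assms by (auto simp: lie_subalgebra_def subspace_gl_iff)
  note v = vectorspace_restrict_gl[OF lie_subalgebra_gl_subspace[OF assms]]
  show ?thesis
  proof (intro lie_algebra.intro[OF v] lie_algebra_axioms.intro, goal_cases)
    case (2 x y z)
    then have c: "x \<in> carrier_mat m m" "y \<in> carrier_mat m m" "z \<in> carrier_mat m m" using H by auto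
    then have "x * z \<in> carrier_mat m m" "y * z \<in> carrier_mat m m" "z * x \<in> carrier_mat m m" "z * y \<in> carrier_mat m m"
      by auto
    with c show ?case
      by (auto simp: add_mult_distrib_mat mult_add_distrib_mat intro!: eq_matI)
  next
    case (3 x y z)
    then have c: "x \<in> carrier_mat m m" "y \<in> carrier_mat m m" "z \<in> carrier_mat m m" using H by auto
    then have "x * z \<in> carrier_mat m m" "y * x \<in> carrier_mat m m" "z * x \<in> carrier_mat m m" "x * y \<in> carrier_mat m m"
      by auto
    with c show ?case
      by (auto simp: add_mult_distrib_mat mult_add_distrib_mat intro!: eq_matI)
  next
    case (4 c x y)
    then have c: "x \<in> carrier_mat m m" "y \<in> carrier_mat m m" using H by auto
    then have "x * y \<in> carrier_mat m m" "y * x \<in> carrier_mat m m"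
      by auto
    with c show ?case
      by (auto simp: algebra_simps mult_smult_distrib mult_smult_assoc_mat intro!: eq_matI)
  next
    case (5 c x y)
    then have c: "x \<in> carrier_mat m m" "y \<in> carrier_mat m m" using H by auto
    then have "x * y \<in> carrier_mat m m" "y * x \<in> carrier_mat m m"
      by auto
    with c show ?case
      by (auto simp: algebra_simps mult_smult_distrib mult_smult_assoc_mat intro!: eq_matI)
  next
    case (6 x)
    then have "x \<in> carrier_mat m m" using H by auto
    then show ?case by (auto intro!: eq_matI)
  next
    case (7 x y z)
    then have c: "x \<in> carrier_mat m m" "y \<in> carrier_mat m m" "z \<in> carrier_mat m m" using H by auto
    \<comment> \<open>The letters stand for the six orderings of x, y, z. Each occurs twice, with
      opposite signs, so the cancellation can be checked entrywise for arbitrary matrices.\<close>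
    have "a - b - d + f + (d - g - h + b) + (h - f - a + g) = 0\<^sub>m m m"
      if "a \<in> carrier_mat m m" "b \<in> carrier_mat m m" "d \<in> carrier_mat m m"
        "f \<in> carrier_mat m m" "g \<in> carrier_mat m m" "h \<in> carrier_mat m m"
      for a b d f g h :: "complex mat"
      using that by (intro eq_matI) auto
    note this[of "x * y * z" "x * z * y" "y * z * x" "z * y * x" "y * x * z" "z * x * y"]
    with 7 commutator_commutator[OF c] commutator_commutator[OF c(2,3,1)]
      commutator_commutator[OF c(3,1,2)] c show ?case by simp
  qed (use H b in auto)
qed

lemma linear_mapI:
  assumes "vectorspace K L" "vectorspace K M" "\<And>x. x \<in> carrier L \<Longrightarrow> f x \<in> carrier M"
    and "\<And>x y. x \<in> carrier L \<Longrightarrow> y \<in> carrier L \<Longrightarrow> f (x \<oplus>\<^bsub>L\<^esub> y) = f x \<oplus>\<^bsub>M\<^esub> f y"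
    and "\<And>c x. c \<in> carrier K \<Longrightarrow> x \<in> carrier L \<Longrightarrow> f (c \<odot>\<^bsub>L\<^esub> x) = c \<odot>\<^bsub>M\<^esub> f x"
  shows "linear_map K L M f"
  using assms vectorspace.axioms(1)[OF assms(1)] vectorspace.axioms(1)[OF assms(2)]
  by (auto simp: linear_map_def mod_hom_def mod_hom_axioms_def LinearCombinations.module_hom_def)

lemma lie_isoI:
  assumes "lie_algebra K L" "lie_algebra K M" "bij_betw f (carrier L) (carrier M)"
    and "\<And>x y. x \<in> carrier L \<Longrightarrow> y \<in> carrier L \<Longrightarrow> f (x \<oplus>\<^bsub>L\<^esub> y) = f x \<oplus>\<^bsub>M\<^esub> f y"
    and "\<And>c x. c \<in> carrier K \<Longrightarrow> x \<in> carrier L \<Longrightarrow> f (c \<odot>\<^bsub>L\<^esub> x) = c \<odot>\<^bsub>M\<^esub> f x"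
    and "\<And>x y. x \<in> carrier L \<Longrightarrow> y \<in> carrier L \<Longrightarrow>
      f (lie_bracket L x y) = lie_bracket M (f x) (f y)"
  shows "lie_iso K L M f"
  unfolding lie_iso_def using assms
  by (auto intro!: linear_mapI lie_algebra.axioms dest: bij_betwE)

lemma internal_direct_sum_restrict_gl:
  assumes W: "subspace class_ring W (gl m)"
    and A: "subspace class_ring A (gl m)" "A \<subseteq> W" and B: "subspace class_ring B (gl m)" "B \<subseteq> W"
    and sum: "\<And>X. X \<in> W \<Longrightarrow> \<exists>Y\<in>A. \<exists>Z\<in>B. X = Y + Z"
    and int: "\<And>X. X \<in> A \<Longrightarrow> X \<in> B \<Longrightarrow> X = 0\<^sub>m m m"
  shows "internal_direct_sum class_ring (lie_restrict (gl m) W) A B"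
proof -
  interpret vectorspace class_ring "lie_restrict (gl m) W"
    by (rule vectorspace_restrict_gl[OF W])
  have "submodule_sum A B = W"
  proof
    show "submodule_sum A B \<subseteq> W"
      using A(2) B(2) W unfolding submodule_sum_def subspace_gl_iff by (auto simp: subset_iff)
    show "W \<subseteq> submodule_sum A B"
    proof
      fix X assume "X \<in> W"
      from sum[OF this] obtain Y Z where "Y \<in> A" "Z \<in> B" "X = Y + Z" by blast
      then show "X \<in> submodule_sum A B" unfolding submodule_sum_def by force
    qed
  qed
  moreover have "A \<inter> B = {0\<^sub>m m m}"
    using int A(1) B(1) unfolding subspace_gl_iff by auto
  ultimately show ?thesis
    unfolding internal_direct_sum_def
    using subspace_restrict_gl[OF W A] subspace_restrict_gl[OF W B] by simp
qed

section \<open>Skew-symmetric matrices with prescribed support\<close>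

text \<open>\<open>R\<close> marks the positions where a nonzero entry is permitted. The everywhere
  true relation gives so(m), and all later subspaces differ only in the choice of
  \<open>R\<close>.\<close>

definition skew :: "nat \<Rightarrow> (nat \<Rightarrow> nat \<Rightarrow> bool) \<Rightarrow> complex mat set" where
  "skew m R = {X \<in> carrier_mat m m. (\<forall>i<m. \<forall>j<m. X $$ (j, i) = - X $$ (i, j)) \<and>
     (\<forall>i<m. \<forall>j<m. \<not> R i j \<longrightarrow> X $$ (i, j) = 0)}"

lemma skewD:
  assumes "X \<in> skew m R"
  shows "X \<in> carrier_mat m m" "\<And>i j. i < m \<Longrightarrow> j < m \<Longrightarrow> X $$ (j, i) = - X $$ (i, j)"
    "\<And>i j. i < m \<Longrightarrow> j < m \<Longrightarrow> \<not> R i j \<Longrightarrow> X $$ (i, j) = 0"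
  using assms unfolding skew_def by blast+

lemma skewI:
  assumes "X \<in> carrier_mat m m" "\<And>i j. i < m \<Longrightarrow> j < m \<Longrightarrow> X $$ (j, i) = - X $$ (i, j)"
    "\<And>i j. i < m \<Longrightarrow> j < m \<Longrightarrow> \<not> R i j \<Longrightarrow> X $$ (i, j) = 0"
  shows "X \<in> skew m R"
  using assms unfolding skew_def by blast

lemma skew_diag: "X \<in> skew m R \<Longrightarrow> i < m \<Longrightarrow> X $$ (i, i) = 0"
  using skewD(2)[of X m R i i] by simp

lemma skew_True_iff:
  "X \<in> skew m (\<lambda>_ _. True) \<longleftrightarrow> X \<in> carrier_mat m m \<and> transpose_mat X = - X"
proof (cases "X \<in> carrier_mat m m")
  case True
  then have "transpose_mat X = - X \<longleftrightarrow> (\<forall>i<m. \<forall>j<m. X $$ (j, i) = - X $$ (i, j))"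
    unfolding mat_eq_iff by simp
  with True show ?thesis unfolding skew_def by blast
qed (auto simp: skew_def)

lemma so_eq: "so m = lie_restrict (gl m) (skew m (\<lambda>_ _. True))"
  by (simp add: so_def skew_True_iff [symmetric])

lemma subspace_skew: "subspace class_ring (skew m R) (gl m)"
  unfolding subspace_gl_iff
proof (intro conjI ballI allI)
  show "skew m R \<subseteq> carrier_mat m m" by (auto dest: skewD(1))
  show "0\<^sub>m m m \<in> skew m R" by (simp add: skew_def)
next
  fix X Y assume X: "X \<in> skew m R" and Y: "Y \<in> skew m R"
  show "X + Y \<in> skew m R"
  proof (rule skewI)
    fix i j assume "i < m" "j < m"
    then show "(X + Y) $$ (j, i) = - (X + Y) $$ (i, j)"
      using skewD(1)[OF X] skewD(1)[OF Y] skewD(2)[OF X, of i j] skewD(2)[OF Y, of i j] by simp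
  qed (use skewD(1,3)[OF X] skewD(1,3)[OF Y] in auto)
next
  fix c X assume X: "X \<in> skew m R"
  show "c \<cdot>\<^sub>m X \<in> skew m R"
  proof (rule skewI)
    fix i j assume "i < m" "j < m"
    then show "(c \<cdot>\<^sub>m X) $$ (j, i) = - (c \<cdot>\<^sub>m X) $$ (i, j)"
      using skewD(1)[OF X] skewD(2)[OF X, of i j] by simp
  qed (use skewD(1,3)[OF X] in auto)
qed

text \<open>Entry (i, j) of a product sums over paths from i through k to j, so it vanishes when no
  such path is allowed. With a single transitive relation this yields subalgebras; with two
  different relations it yields stability of one subspace under commutators with another.\<close>

lemma skew_bracket:
  assumes R: "\<And>i j k. R1 i k \<Longrightarrow> R2 k j \<Longrightarrow> R i j" "\<And>i j k. R2 i k \<Longrightarrow> R1 k j \<Longrightarrow> R i j"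
    and X: "X \<in> skew m R1" and Y: "Y \<in> skew m R2"
  shows "X * Y - Y * X \<in> skew m R"
proof -
  have z: "X $$ (i, k) * Y $$ (k, j) = 0" "Y $$ (i, k) * X $$ (k, j) = 0"
    if "\<not> R i j" "i < m" "j < m" "k < m" for i j k
    using that R[of i k j] skewD(3)[OF X] skewD(3)[OF Y] by (metis mult_eq_0_iff)+
  \<comment> \<open>Transposition reverses the factors of a product, and the two signs coming from
    skewness cancel.\<close>
  have t: "(\<Sum>k = 0..<m. A $$ (j, k) * B $$ (k, i)) = (\<Sum>k = 0..<m. B $$ (i, k) * A $$ (k, j))"
    if "A \<in> skew m S" "B \<in> skew m T" "i < m" "j < m" for A B S T i j
    using that skewD(2)[OF that(1), of _ j] skewD(2)[OF that(2), of i] by (intro sum.cong) auto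
  have idx: "(X * Y - Y * X) $$ (i, j) =
      (\<Sum>k = 0..<m. X $$ (i, k) * Y $$ (k, j)) - (\<Sum>k = 0..<m. Y $$ (i, k) * X $$ (k, j))"
    if "i < m" "j < m" for i j
    using that skewD(1)[OF X] skewD(1)[OF Y] by (simp add: scalar_prod_def)
  show ?thesis
  proof (rule skewI)
    show "X * Y - Y * X \<in> carrier_mat m m"
      using skewD(1)[OF X] skewD(1)[OF Y] by auto
  next
    fix i j assume "i < m" "j < m"
    then show "(X * Y - Y * X) $$ (j, i) = - (X * Y - Y * X) $$ (i, j)"
      by (simp only: idx t[OF X Y, of i j] t[OF Y X, of i j]) simp
  next
    fix i j assume "i < m" "j < m" "\<not> R i j"
    then have "(\<Sum>k = 0..<m. X $$ (i, k) * Y $$ (k, j)) = 0" "(\<Sum>k = 0..<m. Y $$ (i, k) * X $$ (k, j)) = 0"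
      by (auto intro!: sum.neutral z simp del: mult_eq_0_iff)
    with \<open>i < m\<close> \<open>j < m\<close> show "(X * Y - Y * X) $$ (i, j) = 0" by (simp add: idx)
  qed
qed

lemma lie_subalgebra_skew:
  "(\<And>i j k. R i k \<Longrightarrow> R k j \<Longrightarrow> R i j) \<Longrightarrow> lie_subalgebra class_ring (skew m R) (gl m)"
  using subspace_skew[of m R] skew_bracket[of R R R] by (auto simp: lie_subalgebra_def)

lemma lie_algebra_so: "lie_algebra class_ring (so m)"
  unfolding so_eq by (intro lie_algebra_restrict_gl lie_subalgebra_skew)

section \<open>Principal submatrices, and skew-symmetric matrices built from their upper
  triangle\<close>

definition submat :: "nat \<Rightarrow> (nat \<Rightarrow> nat) \<Rightarrow> complex mat \<Rightarrow> complex mat" where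
  "submat k e X = mat k k (\<lambda>(i, j). X $$ (e i, e j))"

lemma submat_carrier [simp]: "submat k e X \<in> carrier_mat k k"
  by (simp add: submat_def)

lemma submat_index [simp]: "i < k \<Longrightarrow> j < k \<Longrightarrow> submat k e X $$ (i, j) = X $$ (e i, e j)"
  "dim_row (submat k e X) = k" "dim_col (submat k e X) = k"
  by (simp_all add: submat_def)

lemma sum_reindex_support:
  fixes h :: "nat \<Rightarrow> complex" and e :: "nat \<Rightarrow> nat"
  assumes e: "bij_betw e {..<k} I" and I: "I \<subseteq> {..<m}" and z: "\<And>l. l < m \<Longrightarrow> l \<notin> I \<Longrightarrow> h l = 0"
  shows "(\<Sum>l = 0..<m. h l) = (\<Sum>l = 0..<k. h (e l))"
proof -
  have "(\<Sum>l = 0..<m. h l) = (\<Sum>l\<in>I. h l)"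
    using I z by (intro sum.mono_neutral_right) auto
  also have "\<dots> = (\<Sum>l\<in>{..<k}. h (e l))"
    using sum.reindex_bij_betw[OF e, of h] by simp
  finally show ?thesis by (simp only: atLeast0LessThan)
qed

text \<open>Deleting indices respects a product as soon as the left factor has no entry leading from
  a kept row to a deleted column: paths through deleted indices then contribute nothing.\<close>

lemma submat_mult:
  assumes e: "bij_betw e {..<k} I" and I: "I \<subseteq> {..<m}"
    and X: "X \<in> carrier_mat m m" and Y: "Y \<in> carrier_mat m m"
    and z: "\<And>i l. i \<in> I \<Longrightarrow> l < m \<Longrightarrow> l \<notin> I \<Longrightarrow> X $$ (i, l) = 0"
  shows "submat k e (X * Y) = submat k e X * submat k e Y"
proof (rule eq_matI)
  fix i j assume "i < dim_row (submat k e X * submat k e Y)" "j < dim_col (submat k e X * submat k e Y)"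
  then have ij: "i < k" "j < k" by auto
  then have "e i \<in> I" "e j \<in> I" using e by (auto simp: bij_betw_def)
  moreover from this have "e i < m" "e j < m" using I by auto
  ultimately show "submat k e (X * Y) $$ (i, j) = (submat k e X * submat k e Y) $$ (i, j)"
    using ij X Y sum_reindex_support[OF e I, of "\<lambda>l. X $$ (e i, l) * Y $$ (l, e j)"] z
    by (simp add: scalar_prod_def)
qed auto

lemma submat_add:
  assumes "\<And>i. i < k \<Longrightarrow> e i < m" "X \<in> carrier_mat m m" "Y \<in> carrier_mat m m"
  shows "submat k e (X + Y) = submat k e X + submat k e Y" "submat k e (X - Y) = submat k e X - submat k e Y"
  using assms by auto

lemma submat_smult:
  assumes "\<And>i. i < k \<Longrightarrow> e i < m" "X \<in> carrier_mat m m"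
  shows "submat k e (c \<cdot>\<^sub>m X) = c \<cdot>\<^sub>m submat k e X"
  using assms by auto

text \<open>The diagonal is exempt from the comparison because a skew-symmetric matrix is zero there
  under either relation.\<close>

lemma skew_mono:
  assumes "\<And>i j. i < m \<Longrightarrow> j < m \<Longrightarrow> i \<noteq> j \<Longrightarrow> R i j \<Longrightarrow> R' i j"
  shows "skew m R \<subseteq> skew m R'"
proof
  fix X assume X: "X \<in> skew m R"
  show "X \<in> skew m R'"
  proof (rule skewI[OF skewD(1,2)[OF X]])
    fix i j assume "i < m" "j < m" "\<not> R' i j"
    then show "X $$ (i, j) = 0"
      using skewD(3)[OF X] skew_diag[OF X] assms by (cases "i = j") blast+
  qed
qed

text \<open>Reading \<open>f\<close> only above the diagonal makes the result skew for every
  \<open>f\<close>. A formula that is meaningful only at i < j can thus describe the inverse of a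
  coordinate map.\<close>

definition skew_mat :: "nat \<Rightarrow> (nat \<Rightarrow> nat \<Rightarrow> bool) \<Rightarrow> (nat \<Rightarrow> nat \<Rightarrow> complex) \<Rightarrow> complex mat" where
  "skew_mat m R f = mat m m (\<lambda>(i, j). if \<not> R i j then 0 else
     if i < j then f i j else if j < i then - f j i else 0)"

lemma skew_mat_carrier [simp]: "skew_mat m R f \<in> carrier_mat m m"
  by (simp add: skew_mat_def)

lemma skew_mat_index:
  "\<lbrakk>i < m; j < m\<rbrakk> \<Longrightarrow> skew_mat m R f $$ (i, j) =
     (if \<not> R i j then 0 else if i < j then f i j else if j < i then - f j i else 0)"
  by (simp add: skew_mat_def)

lemma skew_mat_skew: "symp R \<Longrightarrow> skew_mat m R f \<in> skew m R"
  by (rule skewI) (auto simp: skew_mat_index dest: sympD)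

text \<open>When \<open>f\<close> is itself antisymmetric at the pair, the order of i and j need not
  be known. This is what an enumeration of indices that is not assumed increasing requires.\<close>

lemma skew_mat_index':
  "\<lbrakk>i < m; j < m; R i j; f j i = - f i j; f i i = 0\<rbrakk> \<Longrightarrow> skew_mat m R f $$ (i, j) = f i j"
  by (cases i j rule: linorder_cases) (simp_all add: skew_mat_index)

lemma skew_mat_eq:
  assumes X: "X \<in> skew m R"
    and eq: "\<And>i j. i < j \<Longrightarrow> j < m \<Longrightarrow> R i j \<Longrightarrow> f i j = X $$ (i, j)" and "symp R"
  shows "skew_mat m R f = X"
proof (rule eq_matI)
  fix i j assume "i < dim_row X" "j < dim_col X"
  then have ij: "i < m" "j < m" using skewD(1)[OF X] by auto
  show "skew_mat m R f $$ (i, j) = X $$ (i, j)"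
  proof (cases "R i j")
    case True
    then have "R j i" using \<open>symp R\<close> by (meson sympD)
    with True ij eq[of i j] eq[of j i] skewD(2)[OF X ij] skew_diag[OF X, of i] show ?thesis
      by (cases i j rule: linorder_cases) (simp_all add: skew_mat_index)
  qed (use ij skewD(3)[OF X ij] in \<open>simp add: skew_mat_index\<close>)
qed (use skewD(1)[OF X] in \<open>auto simp: skew_mat_def\<close>)

section \<open>An adapted orthonormal basis\<close>

text \<open>A normalizing factor: q takes the value 2 on e_j + e_{2n+1-j} and -2 on the difference,
  which needs an additional factor \<i>.\<close>

definition rt_half :: complex where
  "rt_half = csqrt (1/2)"

lemma rt_half_sq: "rt_half * rt_half = 1/2"
  by (metis rt_half_def power2_csqrt power2_eq_square)

text \<open>The columns form an orthonormal basis, for the bilinear form \<open>q\<close>, of eigenvectors of the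
  permutation \<open>\<sigma>\<close>; the eigenvalue is \<open>-1\<close> exactly for the columns \<open>n\<close> and \<open>2 n - 1\<close>.\<close>

definition eigenbasis :: "nat \<Rightarrow> complex mat" where
  "eigenbasis n = mat (2 * n) (2 * n) (\<lambda>(i, j).
     if i = j then (if j < n then rt_half else - \<i> * rt_half)
     else if i + j + 1 = 2 * n then (if j < n then rt_half else \<i> * rt_half) else 0)"

lemma eigenbasis_carrier [simp]: "eigenbasis n \<in> carrier_mat (2 * n) (2 * n)"
  by (simp add: eigenbasis_def)

lemma antidiag_carrier [simp]: "antidiag m \<in> carrier_mat m m"
  by (simp add: antidiag_def)

text \<open>Rows and columns of \<open>eigenbasis\<close> are supported on an index and its mirror
  image. These two are distinct because the order of the matrix is even.\<close>

lemma sum_two_points: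
  fixes h :: "nat \<Rightarrow> complex"
  assumes "i < 2 * n" "\<And>k. k < 2 * n \<Longrightarrow> k \<noteq> i \<Longrightarrow> k \<noteq> 2 * n - 1 - i \<Longrightarrow> h k = 0"
  shows "(\<Sum>k = 0..<2 * n. h k) = h i + h (2 * n - 1 - i)"
proof -
  have "(\<Sum>k = 0..<2 * n. h k) = (\<Sum>k\<in>{i, 2 * n - 1 - i}. h k)"
    using assms by (intro sum.mono_neutral_right) auto
  moreover have "i \<noteq> 2 * n - 1 - i" using assms(1) by presburger
  ultimately show ?thesis by simp
qed

lemma sum_one_point:
  fixes h :: "nat \<Rightarrow> complex"
  assumes "i < m" "\<And>k. k < m \<Longrightarrow> k \<noteq> i \<Longrightarrow> h k = 0"
  shows "(\<Sum>k = 0..<m. h k) = h i"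
proof -
  have "(\<Sum>k = 0..<m. h k) = (\<Sum>k\<in>{i}. h k)"
    using assms by (intro sum.mono_neutral_right) auto
  then show ?thesis by simp
qed

lemma antidiag_mult_index:
  assumes X: "X \<in> carrier_mat m m" and ij: "i < m" "j < m"
  shows "(antidiag m * X) $$ (i, j) = X $$ (m - 1 - i, j)"
    "(X * antidiag m) $$ (i, j) = X $$ (i, m - 1 - j)"
proof -
  have "(antidiag m * X) $$ (i, j) = (\<Sum>k = 0..<m. antidiag m $$ (i, k) * X $$ (k, j))"
    using X ij by (simp add: scalar_prod_def antidiag_def)
  also have "\<dots> = antidiag m $$ (i, m - 1 - i) * X $$ (m - 1 - i, j)"
    using ij by (intro sum_one_point) (auto simp: antidiag_def)
  finally show "(antidiag m * X) $$ (i, j) = X $$ (m - 1 - i, j)"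
    using ij by (simp add: antidiag_def)
  have "(X * antidiag m) $$ (i, j) = (\<Sum>k = 0..<m. X $$ (i, k) * antidiag m $$ (k, j))"
    using X ij by (simp add: scalar_prod_def antidiag_def)
  also have "\<dots> = X $$ (i, m - 1 - j) * antidiag m $$ (m - 1 - j, j)"
    using ij by (intro sum_one_point) (auto simp: antidiag_def)
  finally show "(X * antidiag m) $$ (i, j) = X $$ (i, m - 1 - j)"
    using ij by (simp add: antidiag_def)
qed

lemma antidiag_antidiag: "antidiag m * antidiag m = 1\<^sub>m m"
proof (rule eq_matI)
  fix i j assume "i < dim_row (1\<^sub>m m)" "j < dim_col (1\<^sub>m m :: complex mat)"
  then have "i < m" "j < m" by simp_all
  then show "(antidiag m * antidiag m) $$ (i, j) = 1\<^sub>m m $$ (i, j)"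
    by (simp only: antidiag_mult_index(1)[OF antidiag_carrier]) (auto simp: antidiag_def)
qed (simp_all add: antidiag_def)

text \<open>This is orthonormality of the columns in disguise: with A for
  \<open>eigenbasis n\<close>, the equation A A^T = q together with q q = 1 is equivalent to A^T q A
  = 1.\<close>

lemma eigenbasis_transpose:
  "eigenbasis n * transpose_mat (eigenbasis n) = antidiag (2 * n)"
proof (rule eq_matI)
  fix i j assume "i < dim_row (antidiag (2 * n))" "j < dim_col (antidiag (2 * n))"
  then have ij: "i < 2 * n" "j < 2 * n" by (simp_all add: antidiag_def)
  have "(eigenbasis n * transpose_mat (eigenbasis n)) $$ (i, j) =
      (\<Sum>k = 0..<2 * n. eigenbasis n $$ (i, k) * eigenbasis n $$ (j, k))"
    using ij by (simp add: scalar_prod_def eigenbasis_def)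
  also have "\<dots> = eigenbasis n $$ (i, i) * eigenbasis n $$ (j, i)
      + eigenbasis n $$ (i, 2 * n - 1 - i) * eigenbasis n $$ (j, 2 * n - 1 - i)"
    using ij by (intro sum_two_points) (auto simp: eigenbasis_def)
  also have "\<dots> = antidiag (2 * n) $$ (i, j)"
  proof -
    \<comment> \<open>On the diagonal this -1/2 cancels the 1/2 from the other half of the basis. On
      the antidiagonal the two coefficients have opposite signs, and the halves add up to 1.\<close>
    have ii: "\<i> * rt_half * (\<i> * rt_half) = - (1/2)"
      using rt_half_sq by (simp add: algebra_simps)
    consider "j = i" | "i + j + 1 = 2 * n" "j \<noteq> i" | "i + j + 1 \<noteq> 2 * n" "j \<noteq> i" by blast
    then show ?thesis
    proof cases
      case 1
      moreover have "i \<noteq> 2 * n - 1 - i" "i < n \<longleftrightarrow> \<not> 2 * n - 1 - i < n" using ij by presburger+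
      ultimately show ?thesis using ij rt_half_sq ii by (auto simp: eigenbasis_def antidiag_def)
    next
      case 2
      then have "j = 2 * n - 1 - i" "i = 2 * n - 1 - j" "i < n \<longleftrightarrow> \<not> j < n" by presburger+
      then show ?thesis using 2 ij by (auto simp: eigenbasis_def antidiag_def rt_half_sq ii)
    next
      case 3
      then have "j \<noteq> 2 * n - 1 - i" "j + (2 * n - 1 - i) + 1 \<noteq> 2 * n" using ij by presburger+
      then show ?thesis using 3 ij by (auto simp: eigenbasis_def antidiag_def)
    qed
  qed
  finally show "(eigenbasis n * transpose_mat (eigenbasis n)) $$ (i, j) = antidiag (2 * n) $$ (i, j)" .
qed (simp_all add: antidiag_def eigenbasis_def)

text \<open>For a q-orthonormal basis the inverse needs no division: it is the transpose corrected
  by q.\<close>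

definition eigenbasis_inv :: "nat \<Rightarrow> complex mat" where
  "eigenbasis_inv n = transpose_mat (eigenbasis n) * antidiag (2 * n)"

lemma eigenbasis_inv_carrier [simp]: "eigenbasis_inv n \<in> carrier_mat (2 * n) (2 * n)"
  unfolding eigenbasis_inv_def by (rule mult_carrier_mat[of _ _ "2 * n"]) auto

lemma eigenbasis_inverse:
  "eigenbasis n * eigenbasis_inv n = 1\<^sub>m (2 * n)" "eigenbasis_inv n * eigenbasis n = 1\<^sub>m (2 * n)"
proof -
  have "eigenbasis n * eigenbasis_inv n = eigenbasis n * transpose_mat (eigenbasis n) * antidiag (2 * n)"
    unfolding eigenbasis_inv_def
    by (rule assoc_mult_mat[OF eigenbasis_carrier transpose_carrier_mat[THEN iffD2, OF eigenbasis_carrier]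
      antidiag_carrier, symmetric])
  then show *: "eigenbasis n * eigenbasis_inv n = 1\<^sub>m (2 * n)"
    by (simp add: eigenbasis_transpose antidiag_antidiag)
  show "eigenbasis_inv n * eigenbasis n = 1\<^sub>m (2 * n)"
    by (rule mat_mult_left_right_inverse[OF eigenbasis_carrier eigenbasis_inv_carrier *])
qed

lemma mult_cancel_inverse:
  assumes "P \<in> carrier_mat k k" "Q \<in> carrier_mat k k" "P * Q = 1\<^sub>m k" "Q * P = 1\<^sub>m k"
    and "X \<in> carrier_mat k k" "Y \<in> carrier_mat k k"
  shows "P * (Q * X * P) * Q = (X :: complex mat)" "Q * X * P * (Q * Y * P) = Q * (X * Y) * P"
proof -
  have l: "P * (Q * Y) = Y" if "Y \<in> carrier_mat k k" for Y
    using assms that assoc_mult_mat[OF assms(1,2) that] by simp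
  have "P * (Q * X * P) * Q = P * (Q * (X * (P * Q)))"
    using assms by (simp add: assoc_mult_mat[of _ k k _ k _ k])
  then show "P * (Q * X * P) * Q = X" using assms l[of X] by simp
  have "Q * X * P * (Q * Y * P) = Q * (X * (P * (Q * (Y * P))))"
    using assms by (simp add: assoc_mult_mat[of _ k k _ k _ k])
  then show "Q * X * P * (Q * Y * P) = Q * (X * Y) * P"
    using assms l[of "Y * P"] by (simp add: assoc_mult_mat[of _ k k _ k _ k])
qed

lemma conj_linear:
  assumes "P \<in> carrier_mat k k" "Q \<in> carrier_mat k k" "Y \<in> carrier_mat k k" "Z \<in> carrier_mat k k"
  shows "Q * (Y + Z) * P = Q * Y * P + Q * Z * (P :: complex mat)"
    "Q * (Y - Z) * P = Q * Y * P - Q * Z * P"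
proof -
  have c: "Q * Y \<in> carrier_mat k k" "Q * Z \<in> carrier_mat k k" using assms by auto
  show "Q * (Y + Z) * P = Q * Y * P + Q * Z * P"
    by (simp only: mult_add_distrib_mat[OF assms(2-4)] add_mult_distrib_mat[OF c assms(1)])
  show "Q * (Y - Z) * P = Q * Y * P - Q * Z * P"
    by (simp only: mult_minus_distrib_mat[OF assms(2-4)] minus_mult_distrib_mat[OF c assms(1)])
qed

lemma conj_smult:
  assumes "P \<in> carrier_mat k k" "Q \<in> carrier_mat k k" "Z \<in> carrier_mat k k"
  shows "Q * (c \<cdot>\<^sub>m Z) * P = c \<cdot>\<^sub>m (Q * Z * (P :: complex mat))"
  by (simp only: mult_smult_distrib[OF assms(2,3)]
    mult_smult_assoc_mat[OF mult_carrier_mat[OF assms(2,3)] assms(1)])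

section \<open>Conjugation into the adapted basis and back\<close>

definition to_so :: "nat \<Rightarrow> complex mat \<Rightarrow> complex mat" where
  "to_so n Z = eigenbasis_inv n * Z * eigenbasis n"

definition from_so :: "nat \<Rightarrow> complex mat \<Rightarrow> complex mat" where
  "from_so n X = eigenbasis n * X * eigenbasis_inv n"

context
  fixes n m :: nat
  defines "m \<equiv> 2 * n"
begin

lemma to_so_carrier [simp]: "Z \<in> carrier_mat m m \<Longrightarrow> to_so n Z \<in> carrier_mat m m"
  unfolding to_so_def m_def by (intro mult_carrier_mat[of _ _ "2 * n"]) auto

lemma from_so_carrier [simp]: "X \<in> carrier_mat m m \<Longrightarrow> from_so n X \<in> carrier_mat m m"
  unfolding from_so_def m_def by (intro mult_carrier_mat[of _ _ "2 * n"]) auto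

lemma from_so_to_so: "Z \<in> carrier_mat m m \<Longrightarrow> from_so n (to_so n Z) = Z"
  and to_so_from_so: "X \<in> carrier_mat m m \<Longrightarrow> to_so n (from_so n X) = X"
  unfolding from_so_def to_so_def m_def
  by (auto intro!: mult_cancel_inverse(1) eigenbasis_inverse)

lemma to_so_inject: "Y \<in> carrier_mat m m \<Longrightarrow> Z \<in> carrier_mat m m \<Longrightarrow> to_so n Y = to_so n Z \<Longrightarrow> Y = Z"
  by (metis from_so_to_so)

lemma to_so_mult:
  "Y \<in> carrier_mat m m \<Longrightarrow> Z \<in> carrier_mat m m \<Longrightarrow> to_so n (Y * Z) = to_so n Y * to_so n Z"
  unfolding to_so_def m_def
  by (rule mult_cancel_inverse(2)[symmetric]) (auto simp: eigenbasis_inverse)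

lemma to_so_linear:
  assumes "Y \<in> carrier_mat m m" "Z \<in> carrier_mat m m"
  shows "to_so n (Y + Z) = to_so n Y + to_so n Z" "to_so n (Y - Z) = to_so n Y - to_so n Z"
  using assms unfolding to_so_def m_def by (auto intro!: conj_linear)

lemma to_so_smult: "Z \<in> carrier_mat m m \<Longrightarrow> to_so n (c \<cdot>\<^sub>m Z) = c \<cdot>\<^sub>m to_so n Z"
  unfolding to_so_def m_def by (rule conj_smult[OF eigenbasis_carrier eigenbasis_inv_carrier])

lemma from_so_add:
  assumes "Y \<in> carrier_mat m m" "Z \<in> carrier_mat m m"
  shows "from_so n (Y + Z) = from_so n Y + from_so n Z"
  using assms unfolding from_so_def m_def by (auto intro!: conj_linear)

lemma from_so_smult: "Z \<in> carrier_mat m m \<Longrightarrow> from_so n (c \<cdot>\<^sub>m Z) = c \<cdot>\<^sub>m from_so n Z"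
  unfolding from_so_def m_def by (rule conj_smult[OF eigenbasis_inv_carrier eigenbasis_carrier])

lemma to_so_bracket:
  assumes "Y \<in> carrier_mat m m" "Z \<in> carrier_mat m m"
  shows "to_so n (Y * Z - Z * Y) = to_so n Y * to_so n Z - to_so n Z * to_so n Y"
  using assms by (simp add: to_so_linear to_so_mult)

end

section \<open>The subspaces of \<open>\<gg>\<close> in the adapted basis\<close>

text \<open>In a q-orthonormal basis the ordinary transpose represents the q-adjoint, which in the
  original basis is q Z^T q.\<close>

lemma transpose_to_so:
  assumes Z: "Z \<in> carrier_mat (2 * n) (2 * n)"
  shows "transpose_mat (to_so n Z) = to_so n (antidiag (2 * n) * transpose_mat Z * antidiag (2 * n))"
proof -
  let ?m = "2 * n" and ?A = "eigenbasis n" and ?q = "antidiag (2 * n)"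
  have At: "transpose_mat ?A \<in> carrier_mat ?m ?m" and Zt: "transpose_mat Z \<in> carrier_mat ?m ?m"
    using Z eigenbasis_carrier[of n] by auto
  have qt: "transpose_mat ?q = ?q" by (auto simp: antidiag_def add.commute)
  note as = assoc_mult_mat[of _ ?m ?m _ ?m _ ?m]
  have inv_t: "transpose_mat (eigenbasis_inv n) = ?q * ?A"
    unfolding eigenbasis_inv_def by (subst transpose_mult[OF At antidiag_carrier]) (simp add: qt)
  have "eigenbasis_inv n * ?q = transpose_mat ?A * (?q * ?q)"
    unfolding eigenbasis_inv_def by (rule as[OF At]) auto
  then have inv_q: "eigenbasis_inv n * ?q = transpose_mat ?A"
    by (simp only: antidiag_antidiag right_mult_one_mat[OF At])
  have "transpose_mat (to_so n Z) = transpose_mat ?A * (transpose_mat Z * (?q * ?A))"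
    unfolding to_so_def
    by (subst transpose_mult[OF mult_carrier_mat[OF eigenbasis_inv_carrier Z] eigenbasis_carrier])
      (simp add: transpose_mult[OF eigenbasis_inv_carrier Z] inv_t)
  also have "\<dots> = to_so n (?q * transpose_mat Z * ?q)"
    unfolding to_so_def inv_q[symmetric] using Zt
    by (simp add: as mult_carrier_mat[of _ ?m ?m])
  finally show ?thesis .
qed

lemma to_so_uminus:
  assumes "Z \<in> carrier_mat (2 * n) (2 * n)"
  shows "to_so n (- Z) = - to_so n Z"
proof -
  have neg: "- X = (-1) \<cdot>\<^sub>m X" if "X \<in> carrier_mat (2 * n) (2 * n)" for X :: "complex mat"
    using that by auto
  show ?thesis
    using assms to_so_carrier[OF assms] by (simp only: neg to_so_smult[OF assms])
qed

text \<open>Multiplying the defining equation by q on the right gives q Z^T q = -Z, so Z is minus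
  its own q-adjoint. By \<open>transpose_to_so\<close> this is skewness after conjugation.\<close>

lemma g_alg_iff_skew:
  "Z \<in> carrier (g_alg n) \<longleftrightarrow>
     Z \<in> carrier_mat (2 * n) (2 * n) \<and> to_so n Z \<in> skew (2 * n) (\<lambda>_ _. True)"
proof (cases "Z \<in> carrier_mat (2 * n) (2 * n)")
  case Z: True
  let ?m = "2 * n" and ?q = "antidiag (2 * n)"
  \<comment> \<open>Multiplying the transpose by q on both sides reflects Z in its antidiagonal,
    which is how the entries are compared below.\<close>
  let ?W = "?q * transpose_mat Z * ?q"
  have Zt: "transpose_mat Z \<in> carrier_mat ?m ?m" using Z by auto
  then have qZ: "?q * transpose_mat Z \<in> carrier_mat ?m ?m" and W: "?W \<in> carrier_mat ?m ?m"
    by (auto intro!: mult_carrier_mat[of _ ?m ?m])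
  have idx: "?W $$ (i, j) = Z $$ (?m - 1 - j, ?m - 1 - i)" if "i < ?m" "j < ?m" for i j
    using that Z by (simp add: antidiag_mult_index(2)[OF qZ that] antidiag_mult_index(1)[OF Zt])
  have "Z \<in> carrier (g_alg n) \<longleftrightarrow> (\<forall>i<?m. \<forall>j<?m. ?W $$ (i, j) = - Z $$ (i, j))"
  proof
    assume "Z \<in> carrier (g_alg n)"
    then have e: "Z $$ (i, ?m - 1 - j) + Z $$ (j, ?m - 1 - i) = 0" if "i < ?m" "j < ?m" for i j
      using that unfolding g_alg_carrier_iff by blast
    show "\<forall>i<?m. \<forall>j<?m. ?W $$ (i, j) = - Z $$ (i, j)"
    proof (intro allI impI)
      fix i j assume ij: "i < ?m" "j < ?m"
      then have "Z $$ (i, j) + Z $$ (?m - 1 - j, ?m - 1 - i) = 0"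
        using e[of i "?m - 1 - j"] by simp
      then show "?W $$ (i, j) = - Z $$ (i, j)"
        using ij by (simp add: idx add_eq_0_iff)
    qed
  next
    assume e: "\<forall>i<?m. \<forall>j<?m. ?W $$ (i, j) = - Z $$ (i, j)"
    have "Z $$ (i, ?m - 1 - j) + Z $$ (j, ?m - 1 - i) = 0" if ij: "i < ?m" "j < ?m" for i j
    proof -
      have "?W $$ (i, ?m - 1 - j) = - Z $$ (i, ?m - 1 - j)" using e ij by simp
      then show ?thesis using ij by (simp add: idx)
    qed
    then show "Z \<in> carrier (g_alg n)" using Z unfolding g_alg_carrier_iff by blast
  qed
  also have "\<dots> \<longleftrightarrow> ?W = - Z"
    using Z W by (auto simp: mat_eq_iff simp del: index_mult_mat)
  also have "\<dots> \<longleftrightarrow> to_so n ?W = to_so n (- Z)"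
    using to_so_inject[OF W, of "- Z"] Z by auto
  also have "\<dots> \<longleftrightarrow> transpose_mat (to_so n Z) = - to_so n Z"
    by (simp only: transpose_to_so[OF Z] to_so_uminus[OF Z])
  finally show ?thesis using Z by (simp add: skew_True_iff)
qed (simp add: g_alg_carrier_iff)

text \<open>The eigenvalue of the permutation matrix of \<sigma> on column i of
  \<open>eigenbasis\<close>.\<close>

definition eigsign :: "nat \<Rightarrow> nat \<Rightarrow> complex" where
  "eigsign n i = (if i = n \<or> i = 2 * n - 1 then -1 else 1)"

text \<open>A row moved by \<sigma> is exchanged with its mirror image; this fixes the sums and
  negates the differences. In the rows that \<sigma> fixes, the columns with eigenvalue -1 are zero,
  so the sign does no harm there.\<close>

lemma eigenbasis_sigma:
  assumes n: "n > 1" and ij: "i < 2 * n" "j < 2 * n"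
  shows "eigenbasis n $$ (sigma n i, j) = eigenbasis n $$ (i, j) * eigsign n j"
proof -
  \<comment> \<open>Writing n as p + 2 removes truncated subtraction from the index
    computations.\<close>
  obtain p where p: "n = Suc (Suc p)" using n by (cases n rule: nat.exhaust; cases "n - 1") auto
  consider "i = 0" | "i = 2 * n - 1" | "i = n - 1" | "i = n"
    | "i \<noteq> 0" "i \<noteq> 2 * n - 1" "i \<noteq> n - 1" "i \<noteq> n" by blast
  then show ?thesis
  proof cases
    case 5
    then have s: "sigma n i = i" by (simp only: sigma_def if_False)
    have "eigenbasis n $$ (i, j) = 0" if "j = n \<or> j = 2 * n - 1"
      using that 5 ij by (auto simp: eigenbasis_def)
    then show ?thesis by (auto simp: s eigsign_def)
  qed (use ij in \<open>auto simp: p eigenbasis_def sigma_def eigsign_def\<close>)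
qed

text \<open>Since \<sigma> is an involution, \<open>lambda1\<close> is conjugation by its
  permutation matrix P, with P its own inverse. The columns of \<open>eigenbasis\<close> are
  eigenvectors of P, so after the change of basis P becomes the diagonal matrix D of signs.\<close>

lemma to_so_lambda1:
  assumes n: "n > 1" and Z: "Z \<in> carrier_mat (2 * n) (2 * n)" and ij: "i < 2 * n" "j < 2 * n"
  shows "to_so n (lambda1 n Z) $$ (i, j) = eigsign n i * to_so n Z $$ (i, j) * eigsign n j"
proof -
  define m where "m = 2 * n"
  define P where "P = mat m m (\<lambda>(i, j). if sigma n i = j then 1 else 0 :: complex)"
  define D where "D = mat m m (\<lambda>(i, j). if i = j then eigsign n i else 0)"
  let ?A = "eigenbasis n" and ?B = "eigenbasis_inv n"
  have c [simp]: "P \<in> carrier_mat m m" "D \<in> carrier_mat m m" "?A \<in> carrier_mat m m" "?B \<in> carrier_mat m m"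
      "Z \<in> carrier_mat m m"
    using Z by (simp_all add: P_def D_def m_def)
  have mc [simp]: "X * Y \<in> carrier_mat m m" if "X \<in> carrier_mat m m" "Y \<in> carrier_mat m m"
    for X Y :: "complex mat" using that by auto
  note as = assoc_mult_mat[of _ m m _ m _ m]
  have s: "sigma n i < m" if "i < m" for i using that n sigma_less by (simp add: m_def)
  have si: "sigma n k = j \<longleftrightarrow> k = sigma n j" for k j using sigma_sigma[OF n] by metis
  have Pl: "(P * X) $$ (i, j) = X $$ (sigma n i, j)"
    if "X \<in> carrier_mat m m" "i < m" "j < m" for X i j
  proof -
    have "(P * X) $$ (i, j) = (\<Sum>k = 0..<m. P $$ (i, k) * X $$ (k, j))"
      using that by (simp add: scalar_prod_def P_def)
    also have "\<dots> = P $$ (i, sigma n i) * X $$ (sigma n i, j)"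
      using that s by (intro sum_one_point) (auto simp: P_def)
    finally show ?thesis using that s by (simp add: P_def)
  qed
  have Pr: "(X * P) $$ (i, j) = X $$ (i, sigma n j)"
    if "X \<in> carrier_mat m m" "i < m" "j < m" for X i j
  proof -
    have "(X * P) $$ (i, j) = (\<Sum>k = 0..<m. X $$ (i, k) * P $$ (k, j))"
      using that by (simp add: scalar_prod_def P_def)
    also have "\<dots> = X $$ (i, sigma n j) * P $$ (sigma n j, j)"
      using that s by (intro sum_one_point) (auto simp: P_def si)
    finally show ?thesis using that s by (simp add: P_def sigma_sigma[OF n])
  qed
  have Dl: "(D * X) $$ (i, j) = eigsign n i * X $$ (i, j)"
    if "X \<in> carrier_mat m m" "i < m" "j < m" for X i j
  proof -
    have "(D * X) $$ (i, j) = (\<Sum>k = 0..<m. D $$ (i, k) * X $$ (k, j))"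
      using that by (simp add: scalar_prod_def D_def)
    also have "\<dots> = D $$ (i, i) * X $$ (i, j)"
      using that by (intro sum_one_point) (auto simp: D_def)
    finally show ?thesis using that by (simp add: D_def)
  qed
  have Dr: "(X * D) $$ (i, j) = X $$ (i, j) * eigsign n j"
    if "X \<in> carrier_mat m m" "i < m" "j < m" for X i j
  proof -
    have "(X * D) $$ (i, j) = (\<Sum>k = 0..<m. X $$ (i, k) * D $$ (k, j))"
      using that by (simp add: scalar_prod_def D_def)
    also have "\<dots> = X $$ (i, j) * D $$ (j, j)"
      using that by (intro sum_one_point) (auto simp: D_def)
    finally show ?thesis using that by (simp add: D_def)
  qed
  have eqI: "X = Y" if "X \<in> carrier_mat m m" "Y \<in> carrier_mat m m"
    "\<And>i j. i < m \<Longrightarrow> j < m \<Longrightarrow> X $$ (i, j) = Y $$ (i, j)" for X Y :: "complex mat"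
    using that by (intro eq_matI) auto
  have es: "?A $$ (sigma n i, j) = ?A $$ (i, j) * eigsign n j" if "i < m" "j < m" for i j
    using that eigenbasis_sigma[OF n] by (simp add: m_def)
  have PA: "P * ?A = ?A * D"
    by (intro eqI) (simp_all add: Pl Dr es del: index_mult_mat)
  have AB: "?A * ?B = 1\<^sub>m m" "?B * ?A = 1\<^sub>m m" by (simp_all add: eigenbasis_inverse m_def)
  \<comment> \<open>The eigenvector equation P A = A D is converted into B P = D B for the inverse B
    of A, so that P can be absorbed on the left as well.\<close>
  have "P = P * (?A * ?B)" by (simp only: AB right_mult_one_mat[OF c(1)])
  also have "\<dots> = ?A * (D * ?B)" by (simp add: as PA flip: as[of P ?A ?B])
  finally have "?B * P = ?B * (?A * (D * ?B))" by simp
  also have "\<dots> = 1\<^sub>m m * (D * ?B)" by (simp add: AB flip: as[of ?B ?A "D * ?B"])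
  also have "\<dots> = D * ?B" by (rule left_mult_one_mat[of _ m m]) simp
  finally have BP: "?B * P = D * ?B" .
  have li: "lambda1 n Z $$ (i, j) = Z $$ (sigma n i, sigma n j)" if "i < m" "j < m" for i j
    using that lambda1_index[OF n] by (simp add: m_def)
  have "lambda1 n Z \<in> carrier_mat m m" by (simp add: m_def)
  then have "lambda1 n Z = P * (Z * P)"
    by (intro eqI) (simp_all add: Pl Pr s li del: index_mult_mat)
  then have "to_so n (lambda1 n Z) = ?B * P * (Z * (P * ?A))"
    by (simp add: to_so_def as)
  also have "\<dots> = D * (to_so n Z * D)"
    by (simp add: BP PA to_so_def as)
  finally show ?thesis
    using ij to_so_carrier[OF Z] by (simp add: Dl Dr m_def[symmetric] del: index_mult_mat)
qed

text \<open>The index \<open>0\<close> below is the basis vector proportional to \<open>e\<^sub>1 + e\<^bsub>2n\<^esub>\<close>.\<close>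

definition g0_support :: "nat \<Rightarrow> nat \<Rightarrow> nat \<Rightarrow> bool" where
  "g0_support n i j \<longleftrightarrow> (i \<in> {n, 2 * n - 1} \<longleftrightarrow> j \<in> {n, 2 * n - 1})"

definition g0_tilde_support :: "nat \<Rightarrow> nat \<Rightarrow> nat \<Rightarrow> bool" where
  "g0_tilde_support n i j \<longleftrightarrow> i \<notin> {0, n, 2 * n - 1} \<and> j \<notin> {0, n, 2 * n - 1}"

text \<open>Keeping \<open>W\<close> and the scalar \<open>c\<close> apart lets one equivalence
  serve both eigenvalue equations, with \<open>W\<close> being \<open>Z\<close> or
  \<open>- Z\<close>.\<close>

lemma to_so_eigenspace_iff:
  assumes n: "n > 1" and Z: "Z \<in> carrier_mat (2 * n) (2 * n)" and W: "W \<in> carrier_mat (2 * n) (2 * n)"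
    and c: "to_so n W = c \<cdot>\<^sub>m to_so n Z"
  shows "lambda1 n Z = W \<longleftrightarrow> (\<forall>i<2 * n. \<forall>j<2 * n.
    eigsign n i * to_so n Z $$ (i, j) * eigsign n j = c * to_so n Z $$ (i, j))"
proof -
  have "lambda1 n Z = W \<longleftrightarrow> to_so n (lambda1 n Z) = to_so n W"
    using to_so_inject[OF lambda1_carrier W] by auto
  then show ?thesis
    using carrier_matD[OF to_so_carrier[OF Z]] carrier_matD[OF to_so_carrier[OF lambda1_carrier, of n Z]]
      to_so_lambda1[OF n Z]
    by (simp add: c mat_eq_iff del: mult_cancel_right1 mult_cancel_left1)
qed

lemma g0_iff_skew:
  assumes n: "n > 1"
  shows "Z \<in> g0 n \<longleftrightarrow> Z \<in> carrier_mat (2 * n) (2 * n) \<and> to_so n Z \<in> skew (2 * n) (g0_support n)"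
proof (cases "Z \<in> carrier_mat (2 * n) (2 * n)")
  case Z: True
  have "to_so n Z = 1 \<cdot>\<^sub>m to_so n Z" by auto
  \<comment> \<open>A product of two signs is 1 exactly when the indices lie in the same eigenspace;
    elsewhere the entry must vanish.\<close>
  moreover have "eigsign n i * x * eigsign n j = 1 * x \<longleftrightarrow> (\<not> g0_support n i j \<longrightarrow> x = 0)" for i j x
    by (auto simp: eigsign_def g0_support_def)
  ultimately have "lambda1 n Z = Z \<longleftrightarrow>
      (\<forall>i<2 * n. \<forall>j<2 * n. \<not> g0_support n i j \<longrightarrow> to_so n Z $$ (i, j) = 0)"
    by (simp only: to_so_eigenspace_iff[OF n Z Z])
  then show ?thesis
    using Z unfolding g0_def g_alg_iff_skew skew_def by blast
qed (simp add: g0_def g_alg_carrier_iff)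

lemma g1_iff_skew:
  assumes n: "n > 1"
  shows "Z \<in> g1 n \<longleftrightarrow>
    Z \<in> carrier_mat (2 * n) (2 * n) \<and> to_so n Z \<in> skew (2 * n) (\<lambda>i j. \<not> g0_support n i j)"
proof (cases "Z \<in> carrier_mat (2 * n) (2 * n)")
  case Z: True
  have "to_so n (- Z) = (-1) \<cdot>\<^sub>m to_so n Z" by (auto simp: to_so_uminus[OF Z])
  moreover have "eigsign n i * x * eigsign n j = (-1) * x \<longleftrightarrow> (\<not> \<not> g0_support n i j \<longrightarrow> x = 0)" for i j x
    by (auto simp: eigsign_def g0_support_def)
  moreover have "- Z \<in> carrier_mat (2 * n) (2 * n)" using Z by simp
  ultimately have "lambda1 n Z = - Z \<longleftrightarrow>
      (\<forall>i<2 * n. \<forall>j<2 * n. \<not> \<not> g0_support n i j \<longrightarrow> to_so n Z $$ (i, j) = 0)"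
    by (simp only: to_so_eigenspace_iff[OF n Z])
  then show ?thesis
    using Z unfolding g1_def g_alg_iff_skew skew_def by blast
qed (simp add: g1_def g_alg_carrier_iff)

text \<open>Column j after conjugation vanishes exactly when Z kills the j-th basis vector, because
  the remaining left factor is invertible.\<close>

lemma to_so_col_zero_iff:
  assumes Z: "Z \<in> carrier_mat (2 * n) (2 * n)" and j: "j < 2 * n"
  shows "(\<forall>i<2 * n. to_so n Z $$ (i, j) = 0) \<longleftrightarrow> (\<forall>i<2 * n. (Z * eigenbasis n) $$ (i, j) = 0)"
proof -
  have zero: "\<forall>i<2 * n. (M * X) $$ (i, j) = 0"
    if "\<forall>i<2 * n. X $$ (i, j) = 0" "M \<in> carrier_mat (2 * n) (2 * n)" "X \<in> carrier_mat (2 * n) (2 * n)"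
    for M X :: "complex mat"
    using that j by (auto simp: scalar_prod_def intro!: sum.neutral)
  have ZA: "Z * eigenbasis n \<in> carrier_mat (2 * n) (2 * n)"
    by (rule mult_carrier_mat[OF Z]) simp
  have e: "to_so n Z = eigenbasis_inv n * (Z * eigenbasis n)"
    unfolding to_so_def by (rule assoc_mult_mat[OF eigenbasis_inv_carrier Z eigenbasis_carrier])
  have "eigenbasis n * to_so n Z = eigenbasis n * eigenbasis_inv n * (Z * eigenbasis n)"
    unfolding e by (rule assoc_mult_mat[symmetric, OF eigenbasis_carrier eigenbasis_inv_carrier ZA])
  then have e': "eigenbasis n * to_so n Z = Z * eigenbasis n"
    by (simp only: eigenbasis_inverse left_mult_one_mat[OF ZA])
  show ?thesis
    using zero[of "to_so n Z" "eigenbasis n"] zero[OF _ eigenbasis_inv_carrier ZA] Z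
    unfolding e' e[symmetric] by auto
qed

lemma mult_eigenbasis_index:
  assumes Z: "Z \<in> carrier_mat (2 * n) (2 * n)" and i: "i < 2 * n" and j: "j < 2 * n"
  shows "(Z * eigenbasis n) $$ (i, j) = Z $$ (i, j) * eigenbasis n $$ (j, j)
    + Z $$ (i, 2 * n - 1 - j) * eigenbasis n $$ (2 * n - 1 - j, j)"
proof -
  have "(Z * eigenbasis n) $$ (i, j) = (\<Sum>k = 0..<2 * n. Z $$ (i, k) * eigenbasis n $$ (k, j))"
    using Z i j by (simp add: scalar_prod_def eigenbasis_def)
  also have "\<dots> = Z $$ (i, j) * eigenbasis n $$ (j, j)
    + Z $$ (i, 2 * n - 1 - j) * eigenbasis n $$ (2 * n - 1 - j, j)"
    using j by (intro sum_two_points) (auto simp: eigenbasis_def)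
  finally show ?thesis .
qed

text \<open>Inside \<open>g_alg\<close> the row conditions follow from the column conditions by
  reflection in the antidiagonal. The column conditions say that Z kills the basis vectors 0, n and
  2n-1, and skewness then clears the corresponding rows.\<close>

lemma g0_tilde_iff_skew:
  assumes n: "n > 1"
  shows "Z \<in> g0_tilde n \<longleftrightarrow>
    Z \<in> carrier_mat (2 * n) (2 * n) \<and> to_so n Z \<in> skew (2 * n) (g0_tilde_support n)"
proof (cases "Z \<in> carrier (g_alg n)")
  case True
  let ?m = "2 * n" and ?X = "to_so n Z"
  have Z: "Z \<in> carrier_mat ?m ?m" and X: "?X \<in> skew ?m (\<lambda>_ _. True)"
    using True by (auto simp: g_alg_iff_skew)
  have e: "Z $$ (i, ?m - 1 - j) = - Z $$ (j, ?m - 1 - i)" if "i < ?m" "j < ?m" for i j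
    using True that unfolding g_alg_carrier_iff by (metis add_eq_0_iff2)
  have r: "Z $$ (?m - 1, j) = - Z $$ (?m - 1 - j, 0)" "Z $$ (0, j) = - Z $$ (?m - 1 - j, ?m - 1)"
    if "j < ?m" for j
    using e[of "?m - 1" "?m - 1 - j"] e[of 0 "?m - 1 - j"] that by simp_all
  have rt: "rt_half \<noteq> 0" using rt_half_sq by auto
  have c0: "(Z * eigenbasis n) $$ (i, 0) = (Z $$ (i, 0) + Z $$ (i, ?m - 1)) * rt_half"
    "(Z * eigenbasis n) $$ (i, ?m - 1) = (Z $$ (i, 0) - Z $$ (i, ?m - 1)) * (\<i> * rt_half)"
    "(Z * eigenbasis n) $$ (i, n) = (Z $$ (i, n - 1) - Z $$ (i, n)) * (\<i> * rt_half)"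
    if "i < ?m" for i
    using that n mult_eigenbasis_index[OF Z that, of 0] mult_eigenbasis_index[OF Z that, of "?m - 1"]
      mult_eigenbasis_index[OF Z that, of n]
    by (auto simp: eigenbasis_def algebra_simps)
  have "Z \<in> g0_tilde n \<longleftrightarrow> (\<forall>j<?m. Z $$ (0, j) = 0) \<and> (\<forall>j<?m. Z $$ (?m - 1, j) = 0) \<and>
      (\<forall>i<?m. Z $$ (i, 0) = 0) \<and> (\<forall>i<?m. Z $$ (i, ?m - 1) = 0) \<and> (\<forall>i<?m. Z $$ (i, n - 1) = Z $$ (i, n))"
    using True Z n by (auto simp: g0_tilde_def vec_eq_iff)
  also have "\<dots> \<longleftrightarrow> (\<forall>i<?m. Z $$ (i, 0) = 0) \<and> (\<forall>i<?m. Z $$ (i, ?m - 1) = 0) \<and>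
      (\<forall>i<?m. Z $$ (i, n - 1) = Z $$ (i, n))"
    using r by auto
  also have "\<dots> \<longleftrightarrow> (\<forall>i<?m. (Z * eigenbasis n) $$ (i, 0) = 0) \<and>
      (\<forall>i<?m. (Z * eigenbasis n) $$ (i, ?m - 1) = 0) \<and> (\<forall>i<?m. (Z * eigenbasis n) $$ (i, n) = 0)"
  proof -
    \<comment> \<open>Killing e_1 and e_{2n} is the same as killing their sum and their difference,
      which are basis vectors 0 and 2n-1 up to scalars.\<close>
    have "a = 0 \<and> b = 0 \<longleftrightarrow> a + b = 0 \<and> a - b = 0" for a b :: complex
      by (auto simp: add_eq_0_iff2)
    then have "Z $$ (i, 0) = 0 \<and> Z $$ (i, ?m - 1) = 0 \<longleftrightarrow>
        (Z * eigenbasis n) $$ (i, 0) = 0 \<and> (Z * eigenbasis n) $$ (i, ?m - 1) = 0"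
      "Z $$ (i, n - 1) = Z $$ (i, n) \<longleftrightarrow> (Z * eigenbasis n) $$ (i, n) = 0" if "i < ?m" for i
      using rt by (simp_all only: c0[OF that] mult_eq_0_iff complex_i_not_zero right_minus_eq simp_thms)
    then show ?thesis by blast
  qed
  also have "\<dots> \<longleftrightarrow> (\<forall>i<?m. ?X $$ (i, 0) = 0) \<and> (\<forall>i<?m. ?X $$ (i, ?m - 1) = 0) \<and>
      (\<forall>i<?m. ?X $$ (i, n) = 0)"
    using to_so_col_zero_iff[OF Z] n by simp
  also have "\<dots> \<longleftrightarrow> (\<forall>i<?m. \<forall>j<?m. \<not> g0_tilde_support n i j \<longrightarrow> ?X $$ (i, j) = 0)"
  proof
    assume c: "(\<forall>i<?m. ?X $$ (i, 0) = 0) \<and> (\<forall>i<?m. ?X $$ (i, ?m - 1) = 0) \<and> (\<forall>i<?m. ?X $$ (i, n) = 0)"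
    show "\<forall>i<?m. \<forall>j<?m. \<not> g0_tilde_support n i j \<longrightarrow> ?X $$ (i, j) = 0"
    proof (intro allI impI)
      fix i j assume ij: "i < ?m" "j < ?m" "\<not> g0_tilde_support n i j"
      then consider "j \<in> {0, n, ?m - 1}" | "i \<in> {0, n, ?m - 1}" by (auto simp: g0_tilde_support_def)
      then show "?X $$ (i, j) = 0"
        using c ij skewD(2)[OF X ij(2,1)] by cases auto
    qed
  next
    assume h: "\<forall>i<?m. \<forall>j<?m. \<not> g0_tilde_support n i j \<longrightarrow> ?X $$ (i, j) = 0"
    have "\<forall>i<?m. ?X $$ (i, j) = 0" if "j \<in> {0, n, ?m - 1}" for j
    proof -
      have "\<not> g0_tilde_support n i j" for i using that by (auto simp: g0_tilde_support_def)
      moreover have "j < ?m" using that n by auto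
      ultimately show ?thesis using h by blast
    qed
    then show "(\<forall>i<?m. ?X $$ (i, 0) = 0) \<and> (\<forall>i<?m. ?X $$ (i, ?m - 1) = 0) \<and> (\<forall>i<?m. ?X $$ (i, n) = 0)"
      by blast
  qed
  finally show ?thesis using Z X unfolding skew_def by blast
next
  case False
  then show ?thesis unfolding g_alg_iff_skew g0_tilde_def skew_def by blast
qed

section \<open>Lie modules and direct sums\<close>

text \<open>The module law is phrased with the subtraction of the structure. Moving the subtrahend
  to the other side leaves only sums, which compute to matrix or vector addition.\<close>

lemma (in abelian_group) eq_minusI:
  "\<lbrakk>a \<in> carrier G; b \<in> carrier G; c \<in> carrier G; a = c \<oplus> b\<rbrakk> \<Longrightarrow> c = a \<ominus> b"
  by (simp add: a_minus_def a_assoc r_neg)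

lemma (in vectorspace) abelian_group_vectorspace: "abelian_group V"
  by unfold_locales

text \<open>The module law here is the Jacobi identity again, checked by the same cancellation of
  six words.\<close>

lemma lie_module_adjoint:
  assumes H: "lie_subalgebra class_ring H (gl m)" and V: "subspace class_ring V (gl m)"
    and HV: "\<And>X Y. X \<in> H \<Longrightarrow> Y \<in> V \<Longrightarrow> X * Y - Y * X \<in> V"
  shows "lie_module class_ring (lie_restrict (gl m) H) (lie_restrict (gl m) V) (lie_bracket (gl m))"
proof -
  have Hc: "X \<in> carrier_mat m m" if "X \<in> H" for X
    using H that by (auto simp: lie_subalgebra_def subspace_gl_iff)
  have Vc: "X \<in> carrier_mat m m" if "X \<in> V" for X
    using V that by (auto simp: subspace_gl_iff)
  \<comment> \<open>Bilinearity of the bracket is taken from the full matrix algebra, since its two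
    arguments come from different subspaces.\<close>
  have "lie_subalgebra class_ring (carrier_mat m m) (gl m)"
    by (auto simp: lie_subalgebra_def subspace_gl_iff)
  then interpret gl: lie_algebra class_ring "lie_restrict (gl m) (carrier_mat m m)"
    by (rule lie_algebra_restrict_gl)
  note v = vectorspace_restrict_gl[OF V]
  interpret V: abelian_group "lie_restrict (gl m) V"
    by (rule vectorspace.abelian_group_vectorspace[OF v])
  show ?thesis
  proof (intro lie_module.intro lie_algebra_restrict_gl[OF H] v lie_module_axioms.intro, goal_cases)
    case (6 x y u)
    then have c: "x \<in> carrier_mat m m" "y \<in> carrier_mat m m" "u \<in> carrier_mat m m"
      using Hc Vc by auto
    have e: "(x * y - y * x) * u - u * (x * y - y * x) =
        - (u * (x * y - y * x) - (x * y - y * x) * u)"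
      using c by (intro eq_matI) auto
    have "x * (y * u - u * y) - (y * u - u * y) * x = (x * y - y * x) * u - u * (x * y - y * x) +
       (y * (x * u - u * x) - (x * u - u * x) * y)"
      unfolding e commutator_commutator[OF c] commutator_commutator[OF c(3,1,2)]
        commutator_commutator[OF c(2,1,3)]
    proof -
      have "a - b - d + f = - (g - f - a + h) + (h - d - b + g)"
        if "a \<in> carrier_mat m m" "b \<in> carrier_mat m m" "d \<in> carrier_mat m m"
          "f \<in> carrier_mat m m" "g \<in> carrier_mat m m" "h \<in> carrier_mat m m"
        for a b d f g h :: "complex mat"
        using that by (intro eq_matI) auto
      from this[of "x * y * u" "x * u * y" "y * u * x" "u * y * x" "u * x * y" "y * x * u"]
      show "x * y * u - x * u * y - y * u * x + u * y * x =
        - (u * x * y - u * y * x - x * y * u + y * x * u) + (y * x * u - y * u * x - x * u * y + u * x * y)"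
        using c by simp
    qed
    moreover have "x * y - y * x \<in> H" using 6 H by (auto simp: lie_subalgebra_def)
    ultimately show ?case
      using 6 HV[of "x * y - y * x" u] HV[of x "y * u - u * y"] HV[of y "x * u - u * x"] HV[of x u] HV[of y u]
      by (intro V.eq_minusI) simp_all
  qed (use gl.bracket_add_left gl.bracket_add_right gl.bracket_smult_left gl.bracket_smult_right HV Hc Vc in auto)
qed

lemma vectorspace_complex_line: "vectorspace class_ring complex_line"
  by (rule vs_criteria[OF class_field])
    (auto simp: complex_line_def algebra_simps intro: exI[of _ "- v" for v])

lemma lie_algebra_complex_lie: "lie_algebra class_ring complex_lie"
proof -
  have "vectorspace class_ring complex_lie"
    by (rule vs_criteria[OF class_field])
      (auto simp: complex_lie_def complex_line_def module.extend_def lie_alg.fields_def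
        algebra_simps intro: exI[of _ "- v" for v])
  then show ?thesis
    by (intro lie_algebra.intro lie_algebra_axioms.intro)
      (auto simp: complex_lie_def complex_line_def module.extend_def lie_alg.fields_def)
qed

lemma lie_direct_sum_simps [simp]:
  "carrier (lie_direct_sum L M) = carrier L \<times> carrier M"
  "zero (lie_direct_sum L M) = (\<zero>\<^bsub>L\<^esub>, \<zero>\<^bsub>M\<^esub>)"
  "add (lie_direct_sum L M) x y = (fst x \<oplus>\<^bsub>L\<^esub> fst y, snd x \<oplus>\<^bsub>M\<^esub> snd y)"
  "smult (lie_direct_sum L M) c x = (c \<odot>\<^bsub>L\<^esub> fst x, c \<odot>\<^bsub>M\<^esub> snd x)"
  "lie_bracket (lie_direct_sum L M) x y = (lie_bracket L (fst x) (fst y), lie_bracket M (snd x) (snd y))"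
  by (simp_all add: lie_direct_sum_def direct_sum_def module.extend_def lie_alg.fields_def)

lemma lie_algebra_direct_sum:
  assumes "lie_algebra K L" "lie_algebra K M"
  shows "lie_algebra K (lie_direct_sum L M)"
proof -
  interpret L: lie_algebra K L by fact
  interpret M: lie_algebra K M by fact
  have "vectorspace K (lie_direct_sum L M)"
  proof (rule vs_criteria[OF L.field_axioms], goal_cases)
    case 3
    show ?case
    proof
      fix v assume "v \<in> carrier (lie_direct_sum L M)"
      then show "\<exists>w\<in>carrier (lie_direct_sum L M). v \<oplus>\<^bsub>lie_direct_sum L M\<^esub> w = \<zero>\<^bsub>lie_direct_sum L M\<^esub>"
        by (intro bexI[of _ "(\<ominus>\<^bsub>L\<^esub> fst v, \<ominus>\<^bsub>M\<^esub> snd v)"]) (auto simp: L.r_neg M.r_neg)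
    qed
  qed (auto simp: L.a_ac M.a_ac L.smult_assoc1 M.smult_assoc1 L.smult_l_distr M.smult_l_distr
      L.smult_r_distr M.smult_r_distr)
  then show ?thesis
    by (intro lie_algebra.intro lie_algebra_axioms.intro)
      (auto simp: L.bracket_closed M.bracket_closed L.bracket_add_left M.bracket_add_left
        L.bracket_add_right M.bracket_add_right L.bracket_smult_left M.bracket_smult_left
        L.bracket_smult_right M.bracket_smult_right L.bracket_self M.bracket_self L.jacobi M.jacobi)
qed

lemma smult_mult_mat_vec:
  assumes "A \<in> carrier_mat r k" "v \<in> carrier_vec k"
  shows "(a \<cdot>\<^sub>m A) *\<^sub>v v = a \<cdot>\<^sub>v (A *\<^sub>v v :: complex vec)"
  using assms by (intro eq_vecI) auto

text \<open>The vector representation is pulled back along \<phi>. Bracket preservation by \<phi> is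
  precisely the module law on the first summand, and the second summand is annihilated.\<close>

lemma lie_module_vector_plus_trivial:
  assumes L: "lie_algebra class_ring (L :: (complex, 'v, 'e) lie_alg_scheme)"
    and c: "\<And>x. x \<in> carrier L \<Longrightarrow> \<phi> x \<in> carrier_mat k k"
    and add: "\<And>x y. x \<in> carrier L \<Longrightarrow> y \<in> carrier L \<Longrightarrow> \<phi> (x \<oplus>\<^bsub>L\<^esub> y) = \<phi> x + \<phi> y"
    and smult: "\<And>a x. x \<in> carrier L \<Longrightarrow> \<phi> (a \<odot>\<^bsub>L\<^esub> x) = a \<cdot>\<^sub>m \<phi> x"
    and bracket: "\<And>x y. x \<in> carrier L \<Longrightarrow> y \<in> carrier L \<Longrightarrow>
      \<phi> (lie_bracket L x y) = \<phi> x * \<phi> y - \<phi> y * \<phi> x"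
  shows "lie_module class_ring L (direct_sum (module_vec TYPE(complex) k) complex_line)
    (direct_sum_act (\<lambda>x v. \<phi> x *\<^sub>v v) (\<lambda>x c. 0))" (is "lie_module _ _ ?N _")
proof -
  have v: "vectorspace class_ring ?N"
    by (intro direct_sum_is_vs vec_vs vectorspace_complex_line)
  interpret N: abelian_group ?N
    by (rule vectorspace.abelian_group_vectorspace[OF v])
  interpret L: lie_algebra class_ring L by (rule L)
  have N: "carrier ?N = carrier_vec k \<times> UNIV" "add ?N = (\<lambda>x y. (fst x + fst y, snd x + snd y))"
    "smult ?N = (\<lambda>a x. (a \<cdot>\<^sub>v fst x, a * snd x))"
    by (auto simp: direct_sum_def complex_line_def module_vec_simps)
  show ?thesis
  proof (intro lie_module.intro L v lie_module_axioms.intro, goal_cases)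
    case (6 x y u)
    then have c': "\<phi> x \<in> carrier_mat k k" "\<phi> y \<in> carrier_mat k k" "fst u \<in> carrier_vec k"
      using c by (auto simp: N)
    have "\<phi> x *\<^sub>v (\<phi> y *\<^sub>v fst u) = \<phi> (lie_bracket L x y) *\<^sub>v fst u + \<phi> y *\<^sub>v (\<phi> x *\<^sub>v fst u)"
      using 6(1,2) c' by (simp add: bracket minus_mult_distrib_mat_vec[of _ k k]
        assoc_mult_mat_vec[of _ k k _ k]) auto
    moreover have "\<phi> (lie_bracket L x y) \<in> carrier_mat k k"
      using 6 by (intro c L.bracket_closed)
    moreover note mult_mat_vec_carrier[of _ k k]
    ultimately show ?case
      using c' by (intro N.eq_minusI) (simp_all add: N direct_sum_act_def)
  qed (auto simp: N direct_sum_act_def c add smult add_mult_distrib_mat_vec[OF c c]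
      mult_add_distrib_mat_vec[OF c] mult_mat_vec[OF c] smult_mult_mat_vec[OF c]
      mult_mat_vec_carrier[OF c])
qed

section \<open>Subspaces with prescribed support\<close>

text \<open>The common form of \<open>g_alg\<close>, \<open>g0\<close>, \<open>g1\<close>,
  \<open>g0_tilde\<close> and the complement V: matrices that become skew with support
  \<open>R\<close> in the adapted basis.\<close>

definition pull :: "nat \<Rightarrow> (nat \<Rightarrow> nat \<Rightarrow> bool) \<Rightarrow> complex mat set" where
  "pull n R = {Z \<in> carrier_mat (2 * n) (2 * n). to_so n Z \<in> skew (2 * n) R}"

lemma pull_carrier: "Z \<in> pull n R \<Longrightarrow> Z \<in> carrier_mat (2 * n) (2 * n)"
  by (simp add: pull_def)

lemma pull_eqs:
  "carrier (g_alg n) = pull n (\<lambda>_ _. True)"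
  "n > 1 \<Longrightarrow> g0 n = pull n (g0_support n)"
  "n > 1 \<Longrightarrow> g1 n = pull n (\<lambda>i j. \<not> g0_support n i j)"
  "n > 1 \<Longrightarrow> g0_tilde n = pull n (g0_tilde_support n)"
  using g_alg_iff_skew g0_iff_skew g1_iff_skew g0_tilde_iff_skew by (auto simp: pull_def)

lemma restrict_g_alg: "lie_restrict (g_alg n) H = lie_restrict (gl (2 * n)) H"
  by (simp add: g_alg_def)

lemma g_alg_eq: "g_alg n = lie_restrict (gl (2 * n)) (pull n (\<lambda>_ _. True))"
  unfolding pull_eqs(1)[symmetric] by (simp add: g_alg_def)

lemma bij_betw_to_so: "bij_betw (to_so n) (pull n R) (skew (2 * n) R)"
proof (rule bij_betw_byWitness[where f' = "from_so n"])
  show "from_so n ` skew (2 * n) R \<subseteq> pull n R"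
    by (auto simp: pull_def to_so_from_so skewD(1))
qed (auto simp: pull_def from_so_to_so to_so_from_so skewD(1))

lemma subspace_pull: "subspace class_ring (pull n R) (gl (2 * n))"
proof -
  have "to_so n (0\<^sub>m (2 * n) (2 * n)) = 0\<^sub>m (2 * n) (2 * n)"
    unfolding to_so_def by (simp add: left_mult_zero_mat[OF eigenbasis_carrier] right_mult_zero_mat[OF eigenbasis_inv_carrier])
  then show ?thesis
    using subspace_skew[of "2 * n" R] unfolding subspace_gl_iff
    by (auto simp: pull_def to_so_linear to_so_smult)
qed

lemma pull_bracket:
  assumes "\<And>i j k. R1 i k \<Longrightarrow> R2 k j \<Longrightarrow> R i j" "\<And>i j k. R2 i k \<Longrightarrow> R1 k j \<Longrightarrow> R i j"
    and "X \<in> pull n R1" "Y \<in> pull n R2"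
  shows "X * Y - Y * X \<in> pull n R"
  using skew_bracket[of R1 R2 R, OF assms(1,2)] assms(3,4)
  by (auto simp: pull_def to_so_bracket minus_carrier_mat)

lemma lie_subalgebra_pull:
  "(\<And>i j k. R i k \<Longrightarrow> R k j \<Longrightarrow> R i j) \<Longrightarrow> lie_subalgebra class_ring (pull n R) (gl (2 * n))"
  using subspace_pull[of n R] pull_bracket[of R R R _ n] by (auto simp: lie_subalgebra_def)

lemma lie_subalgebra_g:
  "lie_subalgebra class_ring (pull n (\<lambda>_ _. True)) (gl (2 * n))"
  "lie_subalgebra class_ring (pull n (g0_support n)) (gl (2 * n))"
  "lie_subalgebra class_ring (pull n (g0_tilde_support n)) (gl (2 * n))"
  by (rule lie_subalgebra_pull; auto simp: g0_support_def g0_tilde_support_def)+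

lemma pull_mono:
  assumes "\<And>i j. i < 2 * n \<Longrightarrow> j < 2 * n \<Longrightarrow> i \<noteq> j \<Longrightarrow> R i j \<Longrightarrow> R' i j"
  shows "pull n R \<subseteq> pull n R'"
  using skew_mono[of "2 * n" R R', OF assms] by (auto simp: pull_def)

text \<open>Entries are sorted by the relation that allows their position; symmetry of each relation
  keeps both parts skew, and disjointness makes the intersection trivial.\<close>

lemma internal_direct_sum_pull:
  assumes sym: "symp R1" "symp R2"
    and R: "\<And>i j. i < 2 * n \<Longrightarrow> j < 2 * n \<Longrightarrow> i \<noteq> j \<Longrightarrow> R i j \<longleftrightarrow> R1 i j \<or> R2 i j"
    and disj: "\<And>i j. \<not> (R1 i j \<and> R2 i j)"
  shows "internal_direct_sum class_ring (lie_restrict (gl (2 * n)) (pull n R)) (pull n R1) (pull n R2)"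
proof (rule internal_direct_sum_restrict_gl[OF subspace_pull subspace_pull _ subspace_pull])
  let ?m = "2 * n"
  show "pull n R1 \<subseteq> pull n R" "pull n R2 \<subseteq> pull n R"
    by (rule pull_mono; use R in blast)+
  fix Z assume Z: "Z \<in> pull n R"
  define X where "X = to_so n Z"
  have Zc: "Z \<in> carrier_mat ?m ?m" and X: "X \<in> skew ?m R" using Z by (auto simp: pull_def X_def)
  define A where "A R' = skew_mat ?m R' (\<lambda>i j. X $$ (i, j))" for R'
  have A: "A R' \<in> carrier_mat ?m ?m" for R' by (simp add: A_def)
  have As: "A R1 \<in> skew ?m R1" "A R2 \<in> skew ?m R2"
    using sym by (auto simp: A_def intro: skew_mat_skew)
  have "X = A R1 + A R2"
  proof (rule eq_matI)
    fix i j assume "i < dim_row (A R1 + A R2)" "j < dim_col (A R1 + A R2)"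
    then have ij: "i < ?m" "j < ?m" using carrier_matD[OF A, of R2] by auto
    have "(A R1 + A R2) $$ (i, j) = A R1 $$ (i, j) + A R2 $$ (i, j)"
      using ij carrier_matD[OF A, of R2] by (intro index_add_mat) auto
    then show "X $$ (i, j) = (A R1 + A R2) $$ (i, j)"
      using ij R[OF ij] disj[of i j] skewD(3)[OF X ij] skew_diag[OF X ij(1)] skewD(2)[OF X ij(2,1)]
      by (cases i j rule: linorder_cases) (auto simp: A_def skew_mat_index)
  qed (use carrier_matD[OF A, of R2] skewD(1)[OF X] in auto)
  then have "Z = from_so n (A R1) + from_so n (A R2)"
    using from_so_to_so[OF Zc] A by (simp add: X_def from_so_add)
  moreover have "from_so n (A R1) \<in> pull n R1" "from_so n (A R2) \<in> pull n R2"
    using As A by (auto simp: pull_def to_so_from_so)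
  ultimately show "\<exists>Y\<in>pull n R1. \<exists>W\<in>pull n R2. Z = Y + W" by blast
next
  let ?m = "2 * n"
  fix Z assume Z: "Z \<in> pull n R1" "Z \<in> pull n R2"
  let ?z = "0\<^sub>m ?m ?m :: complex mat"
  have "to_so n Z \<in> skew ?m R1" "to_so n Z \<in> skew ?m R2" and Zc: "Z \<in> carrier_mat ?m ?m"
    using Z by (auto simp: pull_def)
  then have "to_so n Z = ?z"
    using skewD(3)[of "to_so n Z" ?m R1] skewD(3)[of "to_so n Z" ?m R2] disj carrier_matD[OF to_so_carrier[OF Zc]]
    by (intro eq_matI) (auto, metis)
  moreover have "to_so n ?z = ?z"
    unfolding to_so_def by (simp add: left_mult_zero_mat[OF eigenbasis_carrier] right_mult_zero_mat[OF eigenbasis_inv_carrier])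
  ultimately show "Z = ?z" using to_so_inject[OF Zc, of ?z] by simp
qed

lemma bij_betw_index_inverse:
  assumes "bij_betw e {..<k::nat} I"
  obtains d where "\<And>i. i < k \<Longrightarrow> d (e i) = i" "\<And>i. i < k \<Longrightarrow> e i \<in> I"
    "\<And>i. i \<in> I \<Longrightarrow> e (d i) = i" "\<And>i. i \<in> I \<Longrightarrow> d i < k"
  using that[of "inv_into {..<k} e"] assms bij_betw_inv_into_left[OF assms]
    bij_betw_inv_into_right[OF assms] bij_betwE[OF bij_betw_inv_into[OF assms]] bij_betwE[OF assms]
  by auto

lemma pull_cong:
  assumes "\<And>i j. i < 2 * n \<Longrightarrow> j < 2 * n \<Longrightarrow> i \<noteq> j \<Longrightarrow> R i j \<longleftrightarrow> R' i j"
  shows "pull n R = pull n R'"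
  using pull_mono[of n R R'] pull_mono[of n R' R] assms by blast

lemma submat_skew:
  assumes "\<And>i. i < k \<Longrightarrow> e i < m" and X: "X \<in> skew m R"
  shows "submat k e X \<in> skew k (\<lambda>_ _. True)"
  by (rule skewI) (simp_all add: assms skewD(2)[OF X, symmetric])

lemma bij_betw_submat:
  assumes e: "bij_betw e {..<k} I" and I: "I \<subseteq> {..<m}"
  shows "bij_betw (submat k e) (skew m (\<lambda>i j. i \<in> I \<and> j \<in> I)) (skew k (\<lambda>_ _. True))"
proof -
  define R where "R i j \<longleftrightarrow> i \<in> I \<and> j \<in> I" for i j
  from bij_betw_index_inverse[OF e] obtain d
    where de: "\<And>i. i < k \<Longrightarrow> d (e i) = i" "\<And>i. i < k \<Longrightarrow> e i \<in> I"
      and ed: "\<And>i. i \<in> I \<Longrightarrow> e (d i) = i" "\<And>i. i \<in> I \<Longrightarrow> d i < k" by blast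
  have em: "e i < m" if "i < k" for i using de(2)[OF that] I by auto
  have R: "symp R" by (auto simp: R_def intro: sympI)
  have "bij_betw (submat k e) (skew m R) (skew k (\<lambda>_ _. True))"
  \<comment> \<open>The inverse spreads \<open>Y\<close> over the index set \<open>I\<close> and
    puts zeros elsewhere.\<close>
  proof (rule bij_betw_byWitness[where f' = "\<lambda>Y. skew_mat m R (\<lambda>i j. Y $$ (d i, d j))"])
    show "\<forall>X\<in>skew m R. skew_mat m R (\<lambda>i j. submat k e X $$ (d i, d j)) = X"
      using ed by (auto intro!: skew_mat_eq R simp: R_def)
    show "\<forall>Y\<in>skew k (\<lambda>_ _. True). submat k e (skew_mat m R (\<lambda>i j. Y $$ (d i, d j))) = Y"
    proof
      fix Y assume Y: "Y \<in> skew k (\<lambda>_ _. True)"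
      show "submat k e (skew_mat m R (\<lambda>i j. Y $$ (d i, d j))) = Y"
      proof (rule eq_matI)
        fix i j assume "i < dim_row Y" "j < dim_col Y"
        then have ij: "i < k" "j < k" using skewD(1)[OF Y] by auto
        then have "skew_mat m R (\<lambda>i j. Y $$ (d i, d j)) $$ (e i, e j) = Y $$ (d (e i), d (e j))"
          using de em skewD(2)[OF Y ij] skew_diag[OF Y ij(1)]
          by (intro skew_mat_index') (auto simp: R_def)
        then show "submat k e (skew_mat m R (\<lambda>i j. Y $$ (d i, d j))) $$ (i, j) = Y $$ (i, j)"
          using ij de by simp
      qed (use skewD(1)[OF Y] in auto)
    qed
    show "submat k e ` skew m R \<subseteq> skew k (\<lambda>_ _. True)"
      using submat_skew[of k e m] em by blast
    show "(\<lambda>Y. skew_mat m R (\<lambda>i j. Y $$ (d i, d j))) ` skew k (\<lambda>_ _. True) \<subseteq> skew m R"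
      by (auto intro: skew_mat_skew R)
  qed
  then show ?thesis by (simp add: R_def[abs_def])
qed

lemma g_alg_iso: "lie_iso class_ring (g_alg n) (so (2 * n)) (to_so n)"
  unfolding g_alg_eq so_eq
  by (intro lie_isoI lie_algebra_restrict_gl lie_subalgebra_g(1) lie_subalgebra_skew)
    (auto simp: bij_betw_to_so to_so_linear to_so_smult to_so_bracket pull_carrier)

text \<open>Increasing enumerations of the indices outside \<open>{0, n, 2 n - 1}\<close> and \<open>{n, 2 n - 1}\<close>.\<close>

definition index_so_odd :: "nat \<Rightarrow> nat \<Rightarrow> nat" where
  "index_so_odd n i = (if i < n - 1 then i + 1 else i + 2)"

definition index_so_even :: "nat \<Rightarrow> nat \<Rightarrow> nat" where
  "index_so_even n i = (if i < n then i else i + 1)"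

text \<open>Values below n are shifted by one to skip 0, later ones by two to skip n as well. The
  last index 2n-1 is never reached, which leaves 2n-3 values.\<close>

lemma bij_index_so_odd:
  "n > 1 \<Longrightarrow> bij_betw (index_so_odd n) {..<2 * n - 3} ({..<2 * n} - {0, n, 2 * n - 1})"
  by (rule bij_betw_byWitness[where f' = "\<lambda>j. if j < n then j - 1 else j - 2"])
    (auto simp: index_so_odd_def)

lemma bij_index_so_even:
  "n > 1 \<Longrightarrow> bij_betw (index_so_even n) {..<2 * n - 2} ({..<2 * n} - {n, 2 * n - 1})"
  by (rule bij_betw_byWitness[where f' = "\<lambda>j. if j < n then j else j - 1"])
    (auto simp: index_so_even_def)

lemma index_so_less:
  "n > 1 \<Longrightarrow> i < 2 * n - 3 \<Longrightarrow> index_so_odd n i < 2 * n"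
  "n > 1 \<Longrightarrow> i < 2 * n - 2 \<Longrightarrow> index_so_even n i < 2 * n"
  by (auto simp: index_so_odd_def index_so_even_def)

section \<open>The isomorphism of \<open>g0_tilde\<close> with so(2n-3)\<close>

definition g0_tilde_map :: "nat \<Rightarrow> complex mat \<Rightarrow> complex mat" where
  "g0_tilde_map n Z = submat (2 * n - 3) (index_so_odd n) (to_so n Z)"

lemma g0_tilde_map_add:
  assumes "n > 1" "Y \<in> carrier_mat (2 * n) (2 * n)" "Z \<in> carrier_mat (2 * n) (2 * n)"
  shows "g0_tilde_map n (Y + Z) = g0_tilde_map n Y + g0_tilde_map n Z"
  using assms submat_add(1)[OF index_so_less(1)[OF assms(1)]]
  by (simp add: g0_tilde_map_def to_so_linear)

lemma g0_tilde_map_smult: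
  assumes "n > 1" "Z \<in> carrier_mat (2 * n) (2 * n)"
  shows "g0_tilde_map n (c \<cdot>\<^sub>m Z) = c \<cdot>\<^sub>m g0_tilde_map n Z"
  using assms submat_smult[OF index_so_less(1)[OF assms(1)]]
  by (simp add: g0_tilde_map_def to_so_smult)

lemma g0_tilde_map_carrier [simp]: "g0_tilde_map n Z \<in> carrier_mat (2 * n - 3) (2 * n - 3)"
  by (simp add: g0_tilde_map_def)

text \<open>The support does not connect kept indices with deleted ones, so cutting down to the
  principal submatrix is multiplicative on these matrices.\<close>

lemma g0_tilde_map_bracket:
  assumes n: "n > 1" and YZ: "Y \<in> pull n (g0_tilde_support n)" "Z \<in> pull n (g0_tilde_support n)"
  shows "g0_tilde_map n (Y * Z - Z * Y) =
    g0_tilde_map n Y * g0_tilde_map n Z - g0_tilde_map n Z * g0_tilde_map n Y"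
proof -
  let ?e = "index_so_odd n" and ?I = "{..<2 * n} - {0, n, 2 * n - 1}"
  have z: "to_so n A $$ (i, l) = 0" if "A \<in> pull n (g0_tilde_support n)" "i \<in> ?I" "l < 2 * n" "l \<notin> ?I" for A i l
    using that skewD(3)[of "to_so n A" "2 * n" "g0_tilde_support n" i l]
    by (auto simp: pull_def g0_tilde_support_def)
  have m: "submat (2 * n - 3) ?e (to_so n A * to_so n B) =
      submat (2 * n - 3) ?e (to_so n A) * submat (2 * n - 3) ?e (to_so n B)"
    if "A \<in> pull n (g0_tilde_support n)" "B \<in> pull n (g0_tilde_support n)" for A B
    using that z by (intro submat_mult[OF bij_index_so_odd[OF n]]) (auto simp: pull_carrier)
  have cc: "to_so n Y * to_so n Z \<in> carrier_mat (2 * n) (2 * n)" "to_so n Z * to_so n Y \<in> carrier_mat (2 * n) (2 * n)"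
    using YZ[THEN pull_carrier, THEN to_so_carrier] by auto
  show ?thesis
    using YZ[THEN pull_carrier] submat_add(2)[OF index_so_less(1)[OF n] cc]
    by (simp add: g0_tilde_map_def to_so_bracket m[OF YZ] m[OF YZ(2,1)])
qed

lemma g0_tilde_iso:
  assumes n: "n > 1"
  shows "lie_iso class_ring (lie_restrict (gl (2 * n)) (pull n (g0_tilde_support n))) (so (2 * n - 3))
    (g0_tilde_map n)"
proof -
  let ?I = "{..<2 * n} - {0, n, 2 * n - 1}"
  have "pull n (g0_tilde_support n) = pull n (\<lambda>i j. i \<in> ?I \<and> j \<in> ?I)"
    by (rule pull_cong) (auto simp: g0_tilde_support_def)
  then have "bij_betw (g0_tilde_map n) (pull n (g0_tilde_support n)) (skew (2 * n - 3) (\<lambda>_ _. True))"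
    using bij_betw_trans[OF bij_betw_to_so[of n "\<lambda>i j. i \<in> ?I \<and> j \<in> ?I"]
        bij_betw_submat[OF bij_index_so_odd[OF n]]]
    by (simp add: g0_tilde_map_def[abs_def] comp_def)
  then show ?thesis
    unfolding so_eq
    by (intro lie_isoI lie_algebra_restrict_gl lie_subalgebra_g(3) lie_subalgebra_skew)
      (auto simp: g0_tilde_map_add[OF n] g0_tilde_map_smult[OF n] g0_tilde_map_bracket[OF n] pull_carrier)
qed

definition complement_support :: "nat \<Rightarrow> nat \<Rightarrow> nat \<Rightarrow> bool" where
  "complement_support n i j \<longleftrightarrow> i = 0 \<and> j \<notin> {0, n, 2 * n - 1} \<or> j = 0 \<and> i \<notin> {0, n, 2 * n - 1} \<or>
     i \<in> {n, 2 * n - 1} \<and> j \<in> {n, 2 * n - 1}"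

text \<open>The complement takes the row and column 0 of the so(2n-2) block and the whole so(2)
  block. Position (0, 0) is allowed in \<open>g0_support\<close> but in neither part, a discrepancy
  confined to the diagonal.\<close>

lemma g0_decomposition:
  assumes n: "n > 1"
  shows "internal_direct_sum class_ring (lie_restrict (gl (2 * n)) (pull n (g0_support n)))
    (pull n (g0_tilde_support n)) (pull n (complement_support n))"
  using n by (intro internal_direct_sum_pull)
    (auto simp: symp_def g0_tilde_support_def complement_support_def g0_support_def)

text \<open>Column 0 rather than row 0 is read off, because a commutator then acts on it by left
  multiplication, as in the standard representation. The second coordinate is the only free entry of
  the so(2) block.\<close>

definition complement_map :: "nat \<Rightarrow> complex mat \<Rightarrow> complex vec \<times> complex" where
  "complement_map n Z = (vec (2 * n - 3) (\<lambda>i. to_so n Z $$ (index_so_odd n i, 0)),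
     to_so n Z $$ (n, 2 * n - 1))"

lemma bij_betw_complement_map:
  assumes n: "n > 1"
  shows "bij_betw (complement_map n) (pull n (complement_support n)) (carrier_vec (2 * n - 3) \<times> UNIV)"
proof -
  let ?m = "2 * n" and ?k = "2 * n - 3" and ?e = "index_so_odd n" and ?R = "complement_support n"
  define I where "I = {..<?m} - {0, n, ?m - 1}"
  have I: "i \<in> I \<longleftrightarrow> i < ?m \<and> i \<noteq> 0 \<and> i \<noteq> n \<and> i \<noteq> ?m - 1" for i by (auto simp: I_def)
  from bij_betw_index_inverse[OF bij_index_so_odd[OF n, folded I_def]] obtain d
    where de: "\<And>i. i < ?k \<Longrightarrow> d (?e i) = i" "\<And>i. i < ?k \<Longrightarrow> ?e i \<in> I"
      and ed: "\<And>i. i \<in> I \<Longrightarrow> ?e (d i) = i" "\<And>i. i \<in> I \<Longrightarrow> d i < ?k" by blast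
  have nm: "n < ?m - 1" using n by linarith
  have R: "symp ?R" by (auto simp: complement_support_def symp_def)
  define f where "f X = (vec ?k (\<lambda>i. X $$ (?e i, 0)), X $$ (n, ?m - 1))" for X :: "complex mat"
  \<comment> \<open>Above the diagonal the allowed positions are (0, j) and (n, 2n-1). Row 0 is the
    negative of column 0, hence the minus sign.\<close>
  define g where "g = (\<lambda>(v, c). skew_mat ?m ?R (\<lambda>i j. if i = 0 then - v $ (d j) else c))"
  have "bij_betw f (skew ?m ?R) (carrier_vec ?k \<times> UNIV)"
  proof (rule bij_betw_byWitness[where f' = g])
    show "\<forall>X\<in>skew ?m ?R. g (f X) = X"
    proof
      fix X assume X: "X \<in> skew ?m ?R"
      show "g (f X) = X"
        unfolding g_def f_def split
      proof (rule skew_mat_eq[OF X _ R])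
        fix i j assume ij: "i < j" "j < ?m" "?R i j"
        then consider "i = 0" "j \<in> I" | "i = n" "j = ?m - 1" by (auto simp: complement_support_def I)
        then show "(if i = 0 then - vec ?k (\<lambda>i. X $$ (?e i, 0)) $ d j else X $$ (n, ?m - 1)) = X $$ (i, j)"
        proof cases
          case 1
          then show ?thesis using ed[of j] skewD(2)[OF X, of 0 j] ij by simp
        qed (use n in auto)
      qed
    qed
    show "\<forall>p\<in>carrier_vec ?k \<times> UNIV. f (g p) = p"
    proof
      fix p :: "complex vec \<times> complex" assume "p \<in> carrier_vec ?k \<times> UNIV"
      then obtain v c where p: "p = (v, c)" "v \<in> carrier_vec ?k" by auto
      have "g p $$ (?e i, 0) = v $ i" if "i < ?k" for i
        using de(1)[OF that] de(2)[OF that] n by (simp add: p g_def skew_mat_index complement_support_def I)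
      moreover have "g p $$ (n, ?m - 1) = c"
        using n nm by (simp add: p g_def skew_mat_index complement_support_def)
      ultimately show "f (g p) = p" using p(2) by (auto simp: f_def p(1))
    qed
    show "f ` skew ?m ?R \<subseteq> carrier_vec ?k \<times> UNIV" by (auto simp: f_def)
    show "g ` (carrier_vec ?k \<times> UNIV) \<subseteq> skew ?m ?R"
      by (auto simp: g_def intro: skew_mat_skew R)
  qed
  from bij_betw_trans[OF bij_betw_to_so this] show ?thesis
    by (simp add: f_def[abs_def] complement_map_def[abs_def] comp_def)
qed

text \<open>With A and B the conjugates of Y and Z, A has zero rows and columns at 0, n and 2n-1. In
  column 0 of A B - B A the second product therefore vanishes and the first is A applied to column 0
  of B; at (n, 2n-1) both products vanish.\<close>

lemma complement_map_equivariant: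
  assumes n: "n > 1" and Y: "Y \<in> pull n (g0_tilde_support n)" and Z: "Z \<in> pull n (complement_support n)"
  shows "complement_map n (Y * Z - Z * Y) = (g0_tilde_map n Y *\<^sub>v fst (complement_map n Z), 0)"
proof -
  let ?m = "2 * n" and ?k = "2 * n - 3" and ?e = "index_so_odd n"
  define I where "I = {..<?m} - {0, n, ?m - 1}"
  have I: "i \<in> I \<longleftrightarrow> i < ?m \<and> i \<notin> {0, n, ?m - 1}" for i by (auto simp: I_def)
  note e = bij_index_so_odd[OF n, folded I_def]
  define A where "A = to_so n Y"
  define B where "B = to_so n Z"
  have A: "A \<in> skew ?m (g0_tilde_support n)" and B: "B \<in> skew ?m (complement_support n)"
    using Y Z by (auto simp: pull_def A_def B_def)
  have Az: "A $$ (i, j) = 0" if "i < ?m" "j < ?m" "i \<in> {0, n, ?m - 1} \<or> j \<in> {0, n, ?m - 1}" for i j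
    using skewD(3)[OF A that(1,2)] that(3) by (auto simp: g0_tilde_support_def)
  have eI: "?e i \<in> I" if "i < ?k" for i
    using that bij_betwE[OF e] by simp
  have idx: "(A * B - B * A) $$ (i, j) =
      (\<Sum>l = 0..<?m. A $$ (i, l) * B $$ (l, j)) - (\<Sum>l = 0..<?m. B $$ (i, l) * A $$ (l, j))"
    if "i < ?m" "j < ?m" for i j
    using that skewD(1)[OF A] skewD(1)[OF B] by (simp add: scalar_prod_def)
  have "(A * B - B * A) $$ (?e i, 0) = (\<Sum>l = 0..<?k. A $$ (?e i, ?e l) * B $$ (?e l, 0))" if "i < ?k" for i
  proof -
    have ei: "?e i < ?m" using eI[OF that] by (simp add: I)
    have "(\<Sum>l = 0..<?m. B $$ (?e i, l) * A $$ (l, 0)) = 0"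
      using n by (intro sum.neutral) (simp add: Az)
    moreover have "(\<Sum>l = 0..<?m. A $$ (?e i, l) * B $$ (l, 0)) =
        (\<Sum>l = 0..<?k. A $$ (?e i, ?e l) * B $$ (?e l, 0))"
      using ei by (intro sum_reindex_support[OF e]) (auto simp: I Az)
    ultimately show ?thesis using n ei by (simp add: idx)
  qed
  moreover have "(A * B - B * A) $$ (n, ?m - 1) = 0"
  proof -
    have "(\<Sum>l = 0..<?m. A $$ (n, l) * B $$ (l, ?m - 1)) = 0" "(\<Sum>l = 0..<?m. B $$ (n, l) * A $$ (l, ?m - 1)) = 0"
      using n by (auto intro!: sum.neutral simp: Az)
    then show ?thesis using n by (simp add: idx)
  qed
  moreover have "to_so n (Y * Z - Z * Y) = A * B - B * A"
    using Y Z by (simp add: to_so_bracket pull_carrier A_def B_def)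
  ultimately show ?thesis
    by (auto simp: complement_map_def g0_tilde_map_def A_def[symmetric] B_def[symmetric] scalar_prod_def)
qed

lemma complement_module_iso:
  assumes n: "n > 1"
  shows "lie_module_iso class_ring (lie_restrict (gl (2 * n)) (pull n (g0_tilde_support n)))
    (lie_restrict (gl (2 * n)) (pull n (complement_support n))) (lie_bracket (gl (2 * n)))
    (direct_sum (module_vec TYPE(complex) (2 * n - 3)) complex_line)
    (direct_sum_act (\<lambda>X v. g0_tilde_map n X *\<^sub>v v) (\<lambda>X c. 0)) (complement_map n)"
  unfolding lie_module_iso_def
proof (intro conjI ballI)
  let ?H = "pull n (g0_tilde_support n)" and ?V = "pull n (complement_support n)"
  let ?N = "direct_sum (module_vec TYPE(complex) (2 * n - 3)) complex_line"
  have N: "carrier ?N = carrier_vec (2 * n - 3) \<times> UNIV" "add ?N = (\<lambda>x y. (fst x + fst y, snd x + snd y))"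
    "smult ?N = (\<lambda>a x. (a \<cdot>\<^sub>v fst x, a * snd x))"
    by (auto simp: direct_sum_def complex_line_def module_vec_simps)
  show "lie_module class_ring (lie_restrict (gl (2 * n)) ?H) (lie_restrict (gl (2 * n)) ?V) (lie_bracket (gl (2 * n)))"
    by (intro lie_module_adjoint lie_subalgebra_g subspace_pull pull_bracket[of "g0_tilde_support n" "complement_support n"])
      (auto simp: g0_tilde_support_def complement_support_def)
  show "lie_module class_ring (lie_restrict (gl (2 * n)) ?H) ?N
      (direct_sum_act (\<lambda>X v. g0_tilde_map n X *\<^sub>v v) (\<lambda>X c. 0))"
    by (intro lie_module_vector_plus_trivial lie_algebra_restrict_gl lie_subalgebra_g)
      (auto simp: g0_tilde_map_add[OF n] g0_tilde_map_smult[OF n] g0_tilde_map_bracket[OF n] pull_carrier)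
  show "linear_map class_ring (lie_restrict (gl (2 * n)) ?V) ?N (complement_map n)"
  proof (rule linear_mapI)
    show "vectorspace class_ring ?N" by (intro direct_sum_is_vs vec_vs vectorspace_complex_line)
  next
    fix x y assume "x \<in> carrier (lie_restrict (gl (2 * n)) ?V)" "y \<in> carrier (lie_restrict (gl (2 * n)) ?V)"
    then have c: "x \<in> carrier_mat (2 * n) (2 * n)" "y \<in> carrier_mat (2 * n) (2 * n)" by (auto simp: pull_carrier)
    then show "complement_map n (x \<oplus>\<^bsub>lie_restrict (gl (2 * n)) ?V\<^esub> y) =
        complement_map n x \<oplus>\<^bsub>?N\<^esub> complement_map n y"
      using n carrier_matD[OF to_so_carrier[OF c(2)]] index_so_less(1)[OF n]
      by (auto simp: N complement_map_def to_so_linear)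
  next
    fix a x assume "x \<in> carrier (lie_restrict (gl (2 * n)) ?V)"
    then have c: "x \<in> carrier_mat (2 * n) (2 * n)" by (auto simp: pull_carrier)
    then show "complement_map n (a \<odot>\<^bsub>lie_restrict (gl (2 * n)) ?V\<^esub> x) = a \<odot>\<^bsub>?N\<^esub> complement_map n x"
      using n carrier_matD[OF to_so_carrier[OF c]] index_so_less(1)[OF n]
      by (auto simp: N complement_map_def to_so_smult)
  qed (auto simp: N complement_map_def vectorspace_restrict_gl subspace_pull)
  show "bij_betw (complement_map n) (carrier (lie_restrict (gl (2 * n)) ?V)) (carrier ?N)"
    using bij_betw_complement_map[OF n] by (simp add: N)
qed (use complement_map_equivariant[OF n] in \<open>auto simp: direct_sum_act_def\<close>)

section \<open>The isomorphism of \<open>g0\<close> with the sum of so(2n-2) and a one-dimensional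
  algebra\<close>

definition g0_map :: "nat \<Rightarrow> complex mat \<Rightarrow> complex mat \<times> complex" where
  "g0_map n Z = (submat (2 * n - 2) (index_so_even n) (to_so n Z), to_so n Z $$ (n, 2 * n - 1))"

text \<open>\<open>g0_support\<close> is block diagonal. The block on the indices n and 2n-1 is a
  skew 2 by 2 matrix, hence a single free number.\<close>

lemma bij_betw_g0_map:
  assumes n: "n > 1"
  shows "bij_betw (g0_map n) (pull n (g0_support n)) (skew (2 * n - 2) (\<lambda>_ _. True) \<times> UNIV)"
proof -
  let ?m = "2 * n" and ?k = "2 * n - 2" and ?e = "index_so_even n" and ?R = "g0_support n"
  define I where "I = {..<?m} - {n, ?m - 1}"
  have I: "i \<in> I \<longleftrightarrow> i < ?m \<and> i \<noteq> n \<and> i \<noteq> ?m - 1" for i by (auto simp: I_def)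
  have nm: "n < ?m - 1" using n by linarith
  from bij_betw_index_inverse[OF bij_index_so_even[OF n, folded I_def]] obtain d
    where de: "\<And>i. i < ?k \<Longrightarrow> d (?e i) = i" "\<And>i. i < ?k \<Longrightarrow> ?e i \<in> I"
      and ed: "\<And>i. i \<in> I \<Longrightarrow> ?e (d i) = i" "\<And>i. i \<in> I \<Longrightarrow> d i < ?k" by blast
  have R: "symp ?R" by (auto simp: g0_support_def symp_def)
  define f where "f X = (submat ?k ?e X, X $$ (n, ?m - 1))" for X :: "complex mat"
  \<comment> \<open>Above the diagonal, row n has only the allowed position (n, 2n-1), so the test i
    = n separates the two blocks.\<close>
  define g where "g = (\<lambda>(Y, c). skew_mat ?m ?R (\<lambda>i j. if i = n then c else Y $$ (d i, d j)))"
  have "bij_betw f (skew ?m ?R) (skew ?k (\<lambda>_ _. True) \<times> UNIV)"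
  proof (rule bij_betw_byWitness[where f' = g])
    show "\<forall>X\<in>skew ?m ?R. g (f X) = X"
    proof
      fix X assume X: "X \<in> skew ?m ?R"
      show "g (f X) = X"
        unfolding g_def f_def split
      proof (rule skew_mat_eq[OF X _ R])
        fix i j assume ij: "i < j" "j < ?m" "?R i j"
        then consider "i \<in> I" "j \<in> I" | "i = n" "j = ?m - 1"
          using nm by (auto simp: g0_support_def I)
        then show "(if i = n then X $$ (n, ?m - 1) else submat ?k ?e X $$ (d i, d j)) = X $$ (i, j)"
        proof cases
          case 1
          then show ?thesis using ed[of i] ed[of j] by (simp add: I)
        qed (use n in auto)
      qed
    qed
    show "\<forall>p\<in>skew ?k (\<lambda>_ _. True) \<times> UNIV. f (g p) = p"
    proof
      fix p :: "complex mat \<times> complex" assume "p \<in> skew ?k (\<lambda>_ _. True) \<times> UNIV"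
      then obtain Y c where p: "p = (Y, c)" "Y \<in> skew ?k (\<lambda>_ _. True)" by auto
      have "g p $$ (?e i, ?e j) = Y $$ (i, j)" if "i < ?k" "j < ?k" for i j
      proof -
        have "g p $$ (?e i, ?e j) =
            (\<lambda>i j. if i = n then c else Y $$ (d i, d j)) (?e i) (?e j)"
          unfolding g_def p(1) split
          using de(1)[OF that(1)] de(1)[OF that(2)] de(2)[OF that(1)] de(2)[OF that(2)]
            skewD(2)[OF p(2) that] skew_diag[OF p(2) that(1)]
          by (intro skew_mat_index') (simp_all add: I g0_support_def)
        then show ?thesis
          using de(1)[OF that(1)] de(1)[OF that(2)] de(2)[OF that(1)] by (simp add: I)
      qed
      then have "submat ?k ?e (g p) = Y"
        using skewD(1)[OF p(2)] by (intro eq_matI) auto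
      moreover have "g p $$ (n, ?m - 1) = c"
        using n nm by (simp add: p g_def skew_mat_index g0_support_def)
      ultimately show "f (g p) = p" by (simp add: f_def p(1))
    qed
    show "f ` skew ?m ?R \<subseteq> skew ?k (\<lambda>_ _. True) \<times> UNIV"
      using submat_skew[of ?k ?e ?m] index_so_less(2)[OF n] by (auto simp: f_def)
    show "g ` (skew ?k (\<lambda>_ _. True) \<times> UNIV) \<subseteq> skew ?m ?R"
      by (auto simp: g_def intro: skew_mat_skew R)
  qed
  from bij_betw_trans[OF bij_betw_to_so this] show ?thesis
    by (simp add: f_def[abs_def] g0_map_def[abs_def] comp_def)
qed

text \<open>The second component is zero because so(2) is abelian: a path from n to 2n-1 inside the
  small block always uses a diagonal entry, which vanishes.\<close>

lemma g0_map_bracket: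
  assumes n: "n > 1" and Y: "Y \<in> pull n (g0_support n)" and Z: "Z \<in> pull n (g0_support n)"
  shows "g0_map n (Y * Z - Z * Y) =
    (fst (g0_map n Y) * fst (g0_map n Z) - fst (g0_map n Z) * fst (g0_map n Y), 0)"
proof -
  let ?m = "2 * n" and ?k = "2 * n - 2" and ?e = "index_so_even n"
  define I where "I = {..<?m} - {n, ?m - 1}"
  have I: "i \<in> I \<longleftrightarrow> i < ?m \<and> i \<notin> {n, ?m - 1}" for i by (auto simp: I_def)
  have nm: "n < ?m - 1" using n by linarith
  define A where "A = to_so n Y"
  define B where "B = to_so n Z"
  have A: "A \<in> skew ?m (g0_support n)" and B: "B \<in> skew ?m (g0_support n)"
    using Y Z by (auto simp: pull_def A_def B_def)
  note Ac = skewD(1)[OF A] and Bc = skewD(1)[OF B]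
  have m: "submat ?k ?e (C * D) = submat ?k ?e C * submat ?k ?e D"
    if "C \<in> skew ?m (g0_support n)" "D \<in> skew ?m (g0_support n)" for C D
    using skewD(3)[OF that(1)] skewD(1)[OF that(1)] skewD(1)[OF that(2)]
    by (intro submat_mult[OF bij_index_so_even[OF n, folded I_def]]) (auto simp: I g0_support_def)
  have z: "(C * D) $$ (n, ?m - 1) = 0" if C: "C \<in> skew ?m (g0_support n)" and D: "D \<in> skew ?m (g0_support n)" for C D
  proof -
    have "C $$ (n, l) * D $$ (l, ?m - 1) = 0" if l: "l < ?m" for l
    proof -
      consider "l = n" | "l = ?m - 1" | "\<not> g0_support n n l" by (auto simp: g0_support_def)
      then show ?thesis
        using skew_diag[OF C, of n] skew_diag[OF D, of "?m - 1"] skewD(3)[OF C, of n l] l n by cases auto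
    qed
    then have "(\<Sum>l = 0..<?m. C $$ (n, l) * D $$ (l, ?m - 1)) = 0"
      by (intro sum.neutral) simp
    then show ?thesis using skewD(1)[OF C] skewD(1)[OF D] n by (simp add: scalar_prod_def)
  qed
  have AB: "A * B \<in> carrier_mat ?m ?m" "B * A \<in> carrier_mat ?m ?m" using Ac Bc by auto
  have "to_so n (Y * Z - Z * Y) = A * B - B * A"
    using Y Z by (simp add: to_so_bracket pull_carrier A_def B_def)
  moreover have "submat ?k ?e (A * B - B * A) =
      submat ?k ?e A * submat ?k ?e B - submat ?k ?e B * submat ?k ?e A"
    using submat_add(2)[OF index_so_less(2)[OF n] AB] by (simp add: m[OF A B] m[OF B A])
  moreover have "(A * B - B * A) $$ (n, ?m - 1) = (A * B) $$ (n, ?m - 1) - (B * A) $$ (n, ?m - 1)"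
    using AB nm by (intro index_minus_mat) auto
  ultimately show ?thesis
    by (simp add: g0_map_def z[OF A B] z[OF B A] del: One_nat_def flip: A_def B_def)
qed

lemma g0_iso:
  assumes n: "n > 1"
  shows "lie_iso class_ring (lie_restrict (gl (2 * n)) (pull n (g0_support n)))
    (lie_direct_sum (so (2 * n - 2)) complex_lie) (g0_map n)"
proof (rule lie_isoI[OF lie_algebra_restrict_gl[OF lie_subalgebra_g(2)]
      lie_algebra_direct_sum[OF lie_algebra_so lie_algebra_complex_lie]])
  have C: "carrier complex_lie = UNIV" "add complex_lie = (+)" "smult complex_lie = (*)"
    "lie_bracket complex_lie x y = 0" for x y
    by (simp_all add: complex_lie_def complex_line_def module.extend_def lie_alg.fields_def)
  have S: "carrier (so k) = skew k (\<lambda>_ _. True)" "add (so k) = (+)" "smult (so k) = (\<cdot>\<^sub>m)"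
    "lie_bracket (so k) X Y = X * Y - Y * X" for k X Y
    by (simp_all add: so_eq)
  let ?L = "lie_restrict (gl (2 * n)) (pull n (g0_support n))"
  let ?M = "lie_direct_sum (so (2 * n - 2)) complex_lie"
  show "bij_betw (g0_map n) (carrier ?L) (carrier ?M)"
    using bij_betw_g0_map[OF n] by (simp add: C S)
  fix x assume "x \<in> carrier ?L"
  then have x: "x \<in> pull n (g0_support n)" and xc: "x \<in> carrier_mat (2 * n) (2 * n)"
    by (auto simp: pull_carrier)
  {
    fix c :: complex
    show "g0_map n (c \<odot>\<^bsub>?L\<^esub> x) = c \<odot>\<^bsub>?M\<^esub> g0_map n x"
      using n carrier_matD[OF to_so_carrier[OF xc]] submat_smult[OF index_so_less(2)[OF n] to_so_carrier[OF xc]]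
      by (auto simp: C S g0_map_def to_so_smult[OF xc])
  next
    fix y assume "y \<in> carrier ?L"
    then have y: "y \<in> pull n (g0_support n)" and yc: "y \<in> carrier_mat (2 * n) (2 * n)"
      by (auto simp: pull_carrier)
    show "g0_map n (x \<oplus>\<^bsub>?L\<^esub> y) = g0_map n x \<oplus>\<^bsub>?M\<^esub> g0_map n y"
      using n carrier_matD[OF to_so_carrier[OF yc]]
        submat_add(1)[OF index_so_less(2)[OF n] to_so_carrier[OF xc] to_so_carrier[OF yc]]
      by (auto simp: C S g0_map_def to_so_linear(1)[OF xc yc])
    show "g0_map n (lie_bracket ?L x y) = lie_bracket ?M (g0_map n x) (g0_map n y)"
      using g0_map_bracket[OF n x y] by (simp add: C S)
  }
qed

section \<open>Dimension of a space with prescribed support\<close>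

lemma skew_mat_linear:
  "skew_mat m R (\<lambda>i j. f i j + g i j) = skew_mat m R f + skew_mat m R g"
  "skew_mat m R (\<lambda>i j. c * f i j) = c \<cdot>\<^sub>m skew_mat m R f"
  by (auto simp: skew_mat_def)

text \<open>The entries at allowed positions above the diagonal can be chosen freely and determine
  the matrix, so an enumeration of these positions gives a linear isomorphism from the coordinate
  space of dimension \<open>N\<close>.\<close>

lemma dim_pull:
  assumes R: "symp R" and N: "card {(i, j). i < j \<and> j < 2 * n \<and> R i j} = N"
  shows "vectorspace.fin_dim class_ring (lie_restrict (gl (2 * n)) (pull n R))"
    and "vectorspace.dim class_ring (lie_restrict (gl (2 * n)) (pull n R)) = N"
proof -
  let ?m = "2 * n" and ?W = "lie_restrict (gl (2 * n)) (pull n R)"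
  define T where "T = {(i, j). i < j \<and> j < ?m \<and> R i j}"
  have "finite T" by (rule finite_subset[of _ "{..<?m} \<times> {..<?m}"]) (auto simp: T_def)
  then obtain e where "bij_betw e {0..<card T} T"
    using ex_bij_betw_nat_finite by blast
  then have "bij_betw e {..<N} T" using N by (simp add: T_def atLeast0LessThan)
  from bij_betw_index_inverse[OF this] obtain d
    where de: "\<And>t. t < N \<Longrightarrow> d (e t) = t" "\<And>t. t < N \<Longrightarrow> e t \<in> T"
      and ed: "\<And>p. p \<in> T \<Longrightarrow> e (d p) = p" "\<And>p. p \<in> T \<Longrightarrow> d p < N" by blast
  \<comment> \<open>Outside \<open>T\<close> the value of \<open>d\<close> is unconstrained and may
    point beyond the vector, where entries are unspecified. The default 0 makes the inner function
    linear in \<open>v\<close> at every pair, before the support cuts it down.\<close>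
  define s where "s v = skew_mat ?m R (\<lambda>i j. if d (i, j) < N then v $ d (i, j) else 0)" for v :: "complex vec"
  have s: "s v \<in> carrier_mat ?m ?m" for v by (simp add: s_def)
  define f where "f v = from_so n (s v)" for v
  have add: "f (v + w) = f v + f w" if "v \<in> carrier_vec N" "w \<in> carrier_vec N" for v w
  proof -
    have "s (v + w) = s v + s w"
      unfolding s_def skew_mat_linear(1)[symmetric] using that
      by (intro arg_cong[of _ _ "skew_mat ?m R"]) (auto simp: fun_eq_iff)
    then show ?thesis by (simp add: f_def from_so_add[OF s s])
  qed
  have smult: "f (c \<cdot>\<^sub>v v) = c \<cdot>\<^sub>m f v" if "v \<in> carrier_vec N" for c v
  proof -
    have "s (c \<cdot>\<^sub>v v) = c \<cdot>\<^sub>m s v"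
      unfolding s_def skew_mat_linear(2)[symmetric] using that
      by (intro arg_cong[of _ _ "skew_mat ?m R"]) (auto simp: fun_eq_iff)
    then show ?thesis by (simp add: f_def from_so_smult[OF s])
  qed
  have im: "f v \<in> pull n R" for v
    using s[of v] skew_mat_skew[OF R] by (simp add: f_def pull_def to_so_from_so) (simp add: s_def)
  have inj: "inj_on f (carrier_vec N)"
  proof (rule inj_onI)
    fix v w :: "complex vec" assume v: "v \<in> carrier_vec N" and w: "w \<in> carrier_vec N" and "f v = f w"
    then have e: "s v = s w" using to_so_from_so[OF s] unfolding f_def by metis
    have coord: "s u $$ (fst (e t), snd (e t)) = u $ t" if "t < N" for u t
      using de(1)[OF that] de(2)[OF that] that by (auto simp: s_def skew_mat_index T_def)
    show "v = w"
      using v w coord[of _ v] coord[of _ w] by (intro eq_vecI) (auto simp: e)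
  qed
  have surj: "Z \<in> f ` carrier_vec N" if Z: "Z \<in> pull n R" for Z
  proof -
    let ?X = "to_so n Z"
    have X: "?X \<in> skew ?m R" and Zc: "Z \<in> carrier_mat ?m ?m" using Z by (auto simp: pull_def)
    define v where "v = vec N (\<lambda>t. ?X $$ e t)"
    have "s v = ?X"
      unfolding s_def
    proof (rule skew_mat_eq[OF X _ R])
      fix i j assume "i < j" "j < ?m" "R i j"
      then have "(i, j) \<in> T" by (simp add: T_def)
      from ed[OF this] show "(if d (i, j) < N then v $ d (i, j) else 0) = ?X $$ (i, j)"
        by (simp add: v_def)
    qed
    then have "f v = Z" by (simp add: f_def from_so_to_so[OF Zc])
    moreover have "v \<in> carrier_vec N" by (simp add: v_def)
    ultimately show ?thesis by blast
  qed
  interpret U: vec_space "TYPE(complex)" N .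
  interpret linear_map class_ring "module_vec TYPE(complex) N" ?W f
    by (rule linear_mapI)
      (auto simp: vec_vs vectorspace_restrict_gl subspace_pull module_vec_simps add smult im)
  have bij: "inj_on f (carrier (module_vec TYPE(complex) N))"
    "f ` carrier (module_vec TYPE(complex) N) = carrier ?W"
    using inj surj im by (auto simp: module_vec_simps)
  show "vectorspace.fin_dim class_ring ?W"
    by (rule surj_fin_dim[OF U.fin_dim bij(2)])
  show "vectorspace.dim class_ring ?W = N"
    using dim_eq[OF U.fin_dim bij] U.dim_is_n by simp
qed

text \<open>The square of \<open>I\<close> splits into the increasing pairs, their mirror images and
  the diagonal. The additive form avoids subtraction and halving of natural numbers.\<close>

lemma card_increasing_pairs:
  assumes "finite (I :: nat set)"
  shows "2 * card {(i, j). i \<in> I \<and> j \<in> I \<and> i < j} + card I = card I * card I"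
proof -
  let ?A = "{(i, j). i \<in> I \<and> j \<in> I \<and> i < j}"
  have fin: "finite ?A" by (rule finite_subset[of _ "I \<times> I"]) (use assms in auto)
  have "I \<times> I = ?A \<union> prod.swap ` ?A \<union> (\<lambda>i. (i, i)) ` I"
  proof (intro equalityI subsetI)
    fix p assume "p \<in> I \<times> I"
    then obtain i j where p: "p = (i, j)" "i \<in> I" "j \<in> I" by auto
    then show "p \<in> ?A \<union> prod.swap ` ?A \<union> (\<lambda>i. (i, i)) ` I"
      by (cases i j rule: linorder_cases) (auto simp: image_iff)
  qed auto
  then have "card (I \<times> I) = card (?A \<union> prod.swap ` ?A \<union> (\<lambda>i. (i, i)) ` I)" by simp
  also have "\<dots> = card (?A \<union> prod.swap ` ?A) + card ((\<lambda>i. (i, i)) ` I)"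
    using fin assms by (intro card_Un_disjoint) auto
  also have "card (?A \<union> prod.swap ` ?A) = card ?A + card (prod.swap ` ?A)"
    using fin by (intro card_Un_disjoint) auto
  also have "card (prod.swap ` ?A) = card ?A"
    by (intro card_image) (auto simp: inj_on_def)
  also have "card ((\<lambda>i. (i, i)) ` I) = card I"
    by (intro card_image) (auto simp: inj_on_def)
  finally show ?thesis by (simp add: card_cartesian_product)
qed

text \<open>The so(2n-2) block contributes (n-1)(2n-3) increasing pairs and the so(2) block the
  single pair (n, 2n-1); the sum is 2n^2 - 5n + 4.\<close>

lemma card_g0_support:
  assumes n: "n > 1"
  shows "int (card {(i, j). i < j \<and> j < 2 * n \<and> g0_support n i j}) = 2 * (int n)\<^sup>2 - 5 * int n + 4"
proof -
  define I where "I = {..<2 * n} - {n, 2 * n - 1}"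
  let ?A = "{(i, j). i \<in> I \<and> j \<in> I \<and> i < j}"
  obtain r where r: "2 * n - 1 = r" "2 * n = Suc r" "n < r" using n by (cases "2 * n") auto
  have fin: "finite I" "finite ?A"
    by (simp_all add: I_def) (rule finite_subset[of _ "{..<2 * n} \<times> {..<2 * n}"]; auto)
  have cI: "card I = 2 * n - 2"
    using bij_betw_same_card[OF bij_index_so_even[OF n]] by (simp add: I_def)
  have "{(i, j). i < j \<and> j < 2 * n \<and> g0_support n i j} = insert (n, 2 * n - 1) ?A"
  proof -
    have "i < j \<and> j < 2 * n \<and> g0_support n i j \<longleftrightarrow> i = n \<and> j = r \<or> i \<in> I \<and> j \<in> I \<and> i < j" for i j
      using r by (auto simp: g0_support_def I_def)
    then show ?thesis by (auto simp: r)
  qed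
  moreover have "(n, 2 * n - 1) \<notin> ?A" by (simp add: I_def)
  ultimately have c: "card {(i, j). i < j \<and> j < 2 * n \<and> g0_support n i j} = card ?A + 1"
    by (simp only: card_insert_disjoint[OF fin(2)] Suc_eq_plus1 not_False_eq_True)
  have "2 * int (card ?A) + int (card I) = int (card I) * int (card I)"
    using arg_cong[OF card_increasing_pairs[OF fin(1)], of int] by (simp only: of_nat_add of_nat_mult of_nat_numeral)
  moreover have "int (card I) = 2 * int n - 2" using n by (simp add: cI)
  ultimately have "2 * int (card ?A) = (2 * int n - 2) * (2 * int n - 2) - (2 * int n - 2)" by simp
  then show ?thesis unfolding c by (simp add: power2_eq_square algebra_simps)
qed

lemma g_decomposition:
  assumes n: "n > 1"
  shows "internal_direct_sum class_ring (g_alg n) (g0 n) (g1 n)"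
  unfolding g_alg_eq pull_eqs(2,3)[OF n]
  by (rule internal_direct_sum_pull) (auto simp: symp_def g0_support_def)

text \<open>The quantifiers are nested so that the vector representation in V is the one transported
  by the same \<phi> that identifies \<open>g0_tilde\<close> with so(2n-3).\<close>

theorem mainTheorem6:
  fixes n :: nat
  assumes "n \<ge> 5" and "odd n"
  shows "lie_isomorphic class_ring (g_alg n) (so (2 * n)) \<and>
    internal_direct_sum class_ring (g_alg n) (g0 n) (g1 n) \<and>
    lie_subalgebra class_ring (g0_tilde n) (lie_restrict (g_alg n) (g0 n)) \<and>
    (\<exists>\<phi>. lie_iso class_ring (lie_restrict (g_alg n) (g0_tilde n)) (so (2 * n - 3)) \<phi> \<and>
      (\<exists>V. internal_direct_sum class_ring (lie_restrict (g_alg n) (g0 n)) (g0_tilde n) V \<and>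
        (\<exists>\<psi>. lie_module_iso class_ring (lie_restrict (g_alg n) (g0_tilde n))
          (lie_restrict (g_alg n) V) (lie_bracket (g_alg n))
          (direct_sum (module_vec TYPE(complex) (2 * (n - 2) + 1)) complex_line)
          (direct_sum_act (\<lambda>X v. \<phi> X *\<^sub>v v) (\<lambda>X c. 0)) \<psi>))) \<and>
    lie_isomorphic class_ring (lie_restrict (g_alg n) (g0 n))
      (lie_direct_sum (so (2 * n - 2)) complex_lie) \<and>
    vectorspace.fin_dim class_ring (lie_restrict (g_alg n) (g0 n)) \<and>
    int (vectorspace.dim class_ring (lie_restrict (g_alg n) (g0 n)))
      = 2 * (int n)\<^sup>2 - 5 * int n + 4"
proof -
  have n: "n > 1" using assms by simp
  have dim: "2 * (n - 2) + 1 = 2 * n - 3" using n by linarith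
  have br: "lie_bracket (g_alg n) = lie_bracket (gl (2 * n))" by (simp add: g_alg_def)
  have sym: "symp (g0_support n)" by (auto simp: symp_def g0_support_def)
  have sub: "pull n (g0_tilde_support n) \<subseteq> pull n (g0_support n)"
    by (rule pull_mono) (auto simp: g0_tilde_support_def g0_support_def)
  have subalg: "lie_subalgebra class_ring (pull n (g0_tilde_support n))
      (lie_restrict (gl (2 * n)) (pull n (g0_support n)))"
    using subspace_restrict_gl[OF subspace_pull subspace_pull sub] lie_subalgebra_g(3)[of n]
    by (auto simp: lie_subalgebra_def)
  have dim_g0: "int (vectorspace.dim class_ring (lie_restrict (gl (2 * n)) (pull n (g0_support n)))) =
      2 * (int n)\<^sup>2 - 5 * int n + 4"
    by (simp only: dim_pull(2)[OF sym refl] card_g0_support[OF n])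
  show ?thesis
    unfolding lie_isomorphic_def restrict_g_alg br dim pull_eqs(2,4)[OF n]
    \<comment> \<open>The witnesses are settled by unification: \<phi> becomes
      \<open>g0_tilde_map n\<close>, V becomes \<open>pull n (complement_support n)\<close> and
      \<psi> becomes \<open>complement_map n\<close>.\<close>
    by (intro conjI exI)
      (rule g_alg_iso g_decomposition[OF n, unfolded pull_eqs(2)[OF n]] subalg g0_tilde_iso[OF n]
        g0_decomposition[OF n] complement_module_iso[OF n] g0_iso[OF n] dim_pull(1)[OF sym refl] dim_g0)+
qed

end
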